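(* Let $n\ge1$, let $\varphi$ be a convex $\varphi$-function, let $\chi:\mathbb{R}^n\to\mathbb{R}$ be a kernel, with $\mu>0$ and $\alpha>0$ the constants in the kernel conditions $(\chi 2)$ and $(\chi 4)$ respectively, and let $f\in L^\varphi(\mathbb{R}^n)\cap Lip_\varphi(\nu)$ with $0<\nu\le1$. Suppose in addition that there exist $\theta,\gamma>0$ such that $$\int_{\|\underline{t}\|_2\le\gamma}w^n|\chi(w\underline{t})|\,\|\underline{t}\|_2^\nu\,d\underline{t}=\mathcal{O}(w^{-\theta})\quad\text{as } w\to+\infty.$$ Then there exists $\lambda>0$ such that $$I^\varphi[\lambda(S_wf-f)]=\mathcal{O}(w^{-\epsilon})\quad\text{as } w\to+\infty,\qquad \epsilon:=\min\{\theta,\nu,\mu,\alpha\}.$$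
   Context: **Sampling nodes.** $\Pi^n=(t_{\underline{k}})_{\underline{k}\in\mathbb{Z}^n}$ with $t_{\underline{k}}=(t_{k_1},\dots,t_{k_n})$, where for each $i=1,\dots,n$, $(t_{k_i})_{k_i\in\mathbb{Z}}$ is a sequence of real numbers with $t_{k_i}<t_{k_i+1}$ for all $k_i$, $\lim_{k_i\to\pm\infty}t_{k_i}=\pm\infty$, and there are constants $\Delta,\delta>0$ with $\delta\le\Delta_{k_i}:=t_{k_i+1}-t_{k_i}\le\Delta$ for every $k_i\in\mathbb{Z}$ and every $i$ (the sequence may depend on $i$). **Kernel.** A function $\chi:\mathbb{R}^n\to\mathbb{R}$ is called a kernel if: - $(\chi 1)$ $\chi\in L^1(\mathbb{R}^n)$ and $\chi$ is bounded in a neighborhood of the origin; - $(\chi 2)$ for some $\mu>0$, $A_w(\underline{x})-1=\mathcal{O}(w^{-\mu})$ as $w\to+\infty$, uniformly in $\underline{x}\in\mathbb{R}^n$, where $A_w(\underline{x}):=\sum_{\underline{k}\in\mathbb{Z}^n}\chi(w\underline{x}-t_{\underline{k}})$; - $(\chi 3)$ for some $\beta>0$, $m_{\beta,\Pi^n}(\chi):=\sup_{\underline{u}\in\mathbb{R}^n}\sum_{\underline{k}\in\mathbb{Z}^n}|\chi(\underline{u}-t_{\underline{k}})|\,\|\underline{u}-t_{\underline{k}}\|_2^\beta<+\infty$; - $(\chi 4)$ there exists $\alpha>0$ such that, for every $M>0$, $\int_{\|\underline{u}\|_2>M}w^n|\chi(w\underline{u})|\,d\underline{u}=\mathcal{O}(w^{-\alpha})$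 as $w\to+\infty$. Here $\|\cdot\|_2$ is the Euclidean norm. **Operators.** For $w>0$, $R^w_{\underline{k}}:=\prod_{i=1}^n[t_{k_i}/w,\,t_{k_i+1}/w]$, $A_{\underline{k}}:=\Delta_{k_1}\cdots\Delta_{k_n}$, and the multivariate sampling Kantorovich operator is $$(S_wf)(\underline{x}):=\sum_{\underline{k}\in\mathbb{Z}^n}\chi(w\underline{x}-t_{\underline{k}})\left[\frac{w^n}{A_{\underline{k}}}\int_{R^w_{\underline{k}}}f(\underline{u})\,d\underline{u}\right],\qquad \underline{x}\in\mathbb{R}^n,$$ for locally integrable $f:\mathbb{R}^n\to\mathbb{R}$ such that the series converges for every $\underline{x}$. **Orlicz spaces.** A $\varphi$-function is a function $\varphi:[0,+\infty)\to[0,+\infty)$ that is non-decreasing and continuous, with $\varphi(0)=0$, $\varphi(u)>0$ for $u>0$, and $\lim_{u\to+\infty}\varphi(u)=+\infty$. For $f\in M(\mathbb{R}^n)$ (the Lebesgue measurable functions $f:\mathbb{R}^n\to\mathbb{R}$), $I^\varphi[f]:=\int_{\mathbb{R}^n}\varphi(|f(\underline{x})|)\,d\underline{x}$. The Orlicz space is $L^\varphi(\mathbb{R}^n):=\{f\in M(\mathbb{R}^n): I^\varphi[\lambda f]<+\infty\text{ for some }\lambda>0\}$. For $0<\nu\le1$, $Lip_\varphi(\nu)$ is the set of $f\in M(\mathbb{R}^n)$ for which there exists $\lambda>0$ with $I^\varphi[\lambda(f(\cdot)-f(\cdot+\underline{t}))]=\mathcal{O}(\|\underline{t}\|_2^\nu)$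 as $\|\underline{t}\|_2\to0$, i.e. there are $C,\bar\gamma>0$ such that the left side is $\le C\|\underline{t}\|_2^\nu$ whenever $\|\underline{t}\|_2\le\bar\gamma$. *)

theory Defs
  imports "HOL-Analysis.Analysis" "HOL-Library.Landau_Symbols"
begin

text \<open>
  The kernel is written \<open>K\<close>, as \<open>\<chi>\<close> is the binder for vectors.
  The dimension is \<open>n = CARD('n)\<close>; multi-indices are vectors of type \<open>int ^ 'n\<close>.
  Multi-indexed series are unconditional (hence, for reals, absolute) sums. In
  \<open>sampling_kernel\<close>, (chi1) and (chi3) make \<open>\<Sum>\<^sub>k \<bar>K (u - t\<^sub>k)\<bar>\<close> bounded uniformly in \<open>u\<close>, so the series
  \<open>node_sum\<close> always converges, and so does the series \<open>kantorovich\<close> for every function of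
  the Orlicz space of a convex \<open>\<phi>\<close> (its cell averages are bounded for fixed \<open>w > 0\<close>). Hence
  the convention that \<open>infsum\<close> is 0 on non-summable families is never used.
\<close>

subsection \<open>Sampling nodes\<close>

definition sampling_nodes :: "('n::finite \<Rightarrow> int \<Rightarrow> real) \<Rightarrow> bool" where
  "sampling_nodes t \<longleftrightarrow>
     (\<forall>i k. t i k < t i (k + 1)) \<and>
     (\<forall>i. filterlim (t i) at_top at_top) \<and>
     (\<forall>i. filterlim (t i) at_bot at_bot) \<and>
     (\<exists>\<delta>>0. \<exists>\<Delta>>0. \<forall>i k. \<delta> \<le> t i (k + 1) - t i k \<and> t i (k + 1) - t i k \<le> \<Delta>)"

definition node :: "('n::finite \<Rightarrow> int \<Rightarrow> real) \<Rightarrow> int ^ 'n \<Rightarrow> real ^ 'n" where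
  "node t k = (\<chi> i. t i (k $ i))"

definition cell :: "('n::finite \<Rightarrow> int \<Rightarrow> real) \<Rightarrow> real \<Rightarrow> int ^ 'n \<Rightarrow> (real ^ 'n) set" where
  "cell t w k = cbox (\<chi> i. t i (k $ i) / w) (\<chi> i. t i (k $ i + 1) / w)"

definition cell_volume :: "('n::finite \<Rightarrow> int \<Rightarrow> real) \<Rightarrow> int ^ 'n \<Rightarrow> real" where
  "cell_volume t k = (\<Prod>i\<in>UNIV. t i (k $ i + 1) - t i (k $ i))"

subsection \<open>Kernels\<close>

definition node_sum ::
  "('n::finite \<Rightarrow> int \<Rightarrow> real) \<Rightarrow> (real ^ 'n \<Rightarrow> real) \<Rightarrow> real \<Rightarrow> real ^ 'n \<Rightarrow> real" where
  "node_sum t K w x = (\<Sum>\<^sub>\<infinity>k\<in>UNIV. K (w *\<^sub>R x - node t k))"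

definition abs_moment ::
  "('n::finite \<Rightarrow> int \<Rightarrow> real) \<Rightarrow> (real ^ 'n \<Rightarrow> real) \<Rightarrow> real \<Rightarrow> ennreal" where
  "abs_moment t K \<beta> =
     (SUP u. \<Sum>\<^sub>\<infinity>k\<in>UNIV. ennreal (\<bar>K (u - node t k)\<bar> * norm (u - node t k) powr \<beta>))"

text \<open>
  The exponents \<open>\<mu>\<close> and \<open>\<alpha>\<close> of (chi2) and (chi4) are parameters, since they enter the rate
  of convergence. The constant hidden in the \<open>O\<close> of (chi4) may depend on \<open>M\<close>.
\<close>

definition sampling_kernel ::
  "('n::finite \<Rightarrow> int \<Rightarrow> real) \<Rightarrow> real \<Rightarrow> real \<Rightarrow> (real ^ 'n \<Rightarrow> real) \<Rightarrow> bool" where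
  "sampling_kernel t \<mu> \<alpha> K \<longleftrightarrow>
     \<comment> \<open>(chi1)\<close>
     integrable lebesgue K \<and> (\<exists>r>0. bounded (K ` ball 0 r)) \<and>
     \<comment> \<open>(chi2)\<close>
     \<mu> > 0 \<and>
     (\<exists>C>0. \<forall>\<^sub>F w in at_top. \<forall>x. \<bar>node_sum t K w x - 1\<bar> \<le> C * w powr (- \<mu>)) \<and>
     \<comment> \<open>(chi3)\<close>
     (\<exists>\<beta>>0. abs_moment t K \<beta> < \<infinity>) \<and>
     \<comment> \<open>(chi4)\<close>
     \<alpha> > 0 \<and>
     (\<forall>M>0. (\<lambda>w. LINT u:{u. norm u > M}|lebesgue. w ^ CARD('n) * \<bar>K (w *\<^sub>R u)\<bar>)
              \<in> O[at_top](\<lambda>w. w powr (- \<alpha>)))"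

subsection \<open>Sampling Kantorovich operators\<close>

definition kantorovich ::
  "('n::finite \<Rightarrow> int \<Rightarrow> real) \<Rightarrow> (real ^ 'n \<Rightarrow> real) \<Rightarrow> real \<Rightarrow> (real ^ 'n \<Rightarrow> real)
     \<Rightarrow> real ^ 'n \<Rightarrow> real" where
  "kantorovich t K w f x =
     (\<Sum>\<^sub>\<infinity>k\<in>UNIV. K (w *\<^sub>R x - node t k) *
        (w ^ CARD('n) / cell_volume t k * (LINT u:cell t w k|lebesgue. f u)))"

subsection \<open>Orlicz spaces and Lipschitz classes\<close>

text \<open>Only the values of \<open>\<phi>\<close> on \<open>[0, \<infinity>)\<close> matter; nonnegativity there follows.\<close>

definition phi_function :: "(real \<Rightarrow> real) \<Rightarrow> bool" where
  "phi_function \<phi> \<longleftrightarrow>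
     mono_on {0..} \<phi> \<and> continuous_on {0..} \<phi> \<and> \<phi> 0 = 0 \<and> (\<forall>u>0. \<phi> u > 0) \<and>
     filterlim \<phi> at_top at_top"

definition modular :: "(real \<Rightarrow> real) \<Rightarrow> (real ^ 'n::finite \<Rightarrow> real) \<Rightarrow> ennreal" where
  "modular \<phi> f = (\<integral>\<^sup>+x. ennreal (\<phi> \<bar>f x\<bar>) \<partial>lebesgue)"

definition orlicz_space :: "(real \<Rightarrow> real) \<Rightarrow> (real ^ 'n::finite \<Rightarrow> real) set" where
  "orlicz_space \<phi> =
     {f \<in> borel_measurable lebesgue. \<exists>l>0. modular \<phi> (\<lambda>x. l * f x) < \<infinity>}"

definition lip_class :: "(real \<Rightarrow> real) \<Rightarrow> real \<Rightarrow> (real ^ 'n::finite \<Rightarrow> real) set" where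
  "lip_class \<phi> \<nu> =
     {f \<in> borel_measurable lebesgue.
        \<exists>l>0. \<exists>C>0. \<exists>r>0. \<forall>s. norm s \<le> r \<longrightarrow>
          modular \<phi> (\<lambda>x. l * (f x - f (x + s))) \<le> ennreal (C * norm s powr \<nu>)}"

end

theory Submission
  imports Defs
begin

text \<open>
  Write \<open>\<Phi> u = \<phi> \<bar>u\<bar>\<close>, \<open>\<tau>\<^sub>k = t\<^sub>k / w\<close>, and let \<open>m\<close> bound \<open>\<Sum>\<^sub>k \<bar>K (u - t\<^sub>k)\<bar>\<close>. Up to the term
  \<open>f x (A\<^sub>w x - 1)\<close>, which (chi2) controls, the error at \<open>x\<close> is a \<open>K\<close>-weighted sum of cell averages of
  \<open>f u - f x\<close>. Jensen's inequality, once for the weights \<open>\<bar>K (w x - t\<^sub>k)\<bar> / m\<close> and once on each cell, moves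
  \<open>\<Phi>\<close> inside, where \<open>f u - f x\<close> is split through the intermediate point \<open>u + x - \<tau>\<^sub>k\<close>.
  In the first half, \<open>f u - f (u + (x - \<tau>\<^sub>k))\<close>, the substitution \<open>y = x - \<tau>\<^sub>k\<close> decouples the sum over
  cells from the kernel and leaves \<open>\<integral> w\<^sup>n \<bar>K (w y)\<bar> L y dy\<close>, where \<open>L y\<close> is the modular of
  \<open>f - f (\<cdot> + y)\<close>: near the origin the Lipschitz class and the hypothesis on \<open>\<theta>\<close> apply, away from
  it \<open>L\<close> is bounded and (chi4) applies. In the second half, \<open>f (x + (u - \<tau>\<^sub>k)) - f x\<close>, the shift has
  length \<open>O(1/w)\<close>, which gives the rate \<open>w powr (- \<nu>)\<close>.
\<close>

subsection \<open>Series as integrals over counting measure\<close>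

text \<open>A countable type is exhausted by the finite sets \<open>{k. to_nat k < n}\<close>, so
  monotone convergence reduces the integral to finite partial sums.\<close>

lemma nn_integral_count_space_le:
  fixes f :: "'k::countable \<Rightarrow> ennreal"
  assumes "\<And>F. finite F \<Longrightarrow> sum f F \<le> C"
  shows "(\<integral>\<^sup>+k. f k \<partial>count_space UNIV) \<le> C"
proof -
  let ?F = "\<lambda>n. {k::'k. to_nat k < n}"
  have fin: "finite (?F n)" for n
    using finite_vimageI[OF finite_lessThan[of n] inj_to_nat] by (simp add: vimage_def)
  have "f k = (SUP n. f k * indicator (?F n) k)" for k
  proof (rule antisym)
    show "f k \<le> (SUP n. f k * indicator (?F n) k)"
      by (rule SUP_upper2[of "Suc (to_nat k)"]) auto
    show "(SUP n. f k * indicator (?F n) k) \<le> f k"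
      by (rule SUP_least) (auto split: split_indicator)
  qed
  then have "(\<integral>\<^sup>+k. f k \<partial>count_space UNIV)
      = (\<integral>\<^sup>+k. (SUP n. f k * indicator (?F n) k) \<partial>count_space UNIV)"
    by simp
  also have "\<dots> = (SUP n. \<integral>\<^sup>+k. f k * indicator (?F n) k \<partial>count_space UNIV)"
    by (intro nn_integral_monotone_convergence_SUP)
       (auto simp: incseq_def le_fun_def split: split_indicator)
  also have "\<dots> \<le> C"
  proof (rule SUP_least)
    fix n
    have "(\<integral>\<^sup>+k. f k * indicator (?F n) k \<partial>count_space UNIV) = sum f (?F n)"
      using fin[of n]
      by (simp add: nn_integral_count_space_finite flip: nn_integral_count_space_indicator)
    then show "(\<integral>\<^sup>+k. f k * indicator (?F n) k \<partial>count_space UNIV) \<le> C"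
      using assms[OF fin] by simp
  qed
  finally show ?thesis .
qed

text \<open>In \<open>ennreal\<close> the unordered sum is the supremum of the finite partial sums.
  This carries the bound (chi3) over to counting measure, where Tonelli and Jensen are
  available.\<close>

lemma nn_integral_count_space_le_infsum:
  fixes f :: "'k::countable \<Rightarrow> ennreal"
  shows "(\<integral>\<^sup>+k. f k \<partial>count_space UNIV) \<le> (\<Sum>\<^sub>\<infinity>k\<in>UNIV. f k)"
  by (intro nn_integral_count_space_le) (auto simp: nonneg_infsum_complete intro: SUP_upper)

text \<open>The products are dominated by \<open>B * a k\<close>. Applied with kernel values as
  \<open>a\<close> and differences of cell averages and \<open>f x\<close> as \<open>b\<close>, it
  justifies rearranging the series of the operator.\<close>

lemma mult_bounded_count_space:
  fixes a b :: "'k \<Rightarrow> real"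
  assumes a: "(\<integral>\<^sup>+k. ennreal \<bar>a k\<bar> \<partial>count_space UNIV) < \<infinity>" and b: "\<And>k. \<bar>b k\<bar> \<le> B"
  shows "integrable (count_space UNIV) (\<lambda>k. a k * b k)" "(\<lambda>k. a k * b k) summable_on UNIV"
proof -
  have a_int: "integrable (count_space UNIV) a"
    using a by (intro integrableI_bounded) auto
  show *: "integrable (count_space UNIV) (\<lambda>k. a k * b k)"
  proof (rule Bochner_Integration.integrable_bound)
    show "integrable (count_space UNIV) (\<lambda>k. B * a k)" using a_int by simp
    show "AE k in count_space UNIV. norm (a k * b k) \<le> norm (B * a k)"
    proof (intro AE_I2)
      fix k
      have "\<bar>a k\<bar> * \<bar>b k\<bar> \<le> \<bar>a k\<bar> * \<bar>B\<bar>"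
        using b[of k] by (intro mult_left_mono) auto
      then show "norm (a k * b k) \<le> norm (B * a k)" by (simp add: abs_mult mult.commute)
    qed
  qed auto
  then show "(\<lambda>k. a k * b k) summable_on UNIV"
    using abs_summable_equivalent abs_summable_summable unfolding abs_summable_on_def by blast
qed

text \<open>With countably many indices, measurable sections already give joint measurability, and
  counting measure is sigma-finite. The measure \<open>M\<close> is arbitrary so that sums of merely
  Lebesgue measurable terms are covered.\<close>

lemma borel_measurable_nn_integral_count_space:
  fixes F :: "'k::countable \<Rightarrow> 'a \<Rightarrow> ennreal"
  assumes "\<And>k. F k \<in> borel_measurable M"
  shows "(\<lambda>x. \<integral>\<^sup>+k. F k x \<partial>count_space UNIV) \<in> borel_measurable M"
proof -
  interpret sigma_finite_measure "count_space (UNIV :: 'k set)"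
    by (rule sigma_finite_measure_count_space)
  have "(\<lambda>p. F (snd p) (fst p)) \<in> borel_measurable (M \<Otimes>\<^sub>M count_space UNIV)"
  proof (rule measurable_compose_countable[where f = "\<lambda>k p. F k (fst p)"])
    show "(\<lambda>p. F k (fst p)) \<in> borel_measurable (M \<Otimes>\<^sub>M count_space UNIV)" for k
      by (rule measurable_compose[OF measurable_fst assms])
  qed (rule measurable_snd)
  then have "(\<lambda>(x, k). F k x) \<in> borel_measurable (M \<Otimes>\<^sub>M count_space UNIV)"
    by (simp only: case_prod_unfold)
  then show ?thesis by (rule borel_measurable_nn_integral)
qed

subsection \<open>Translations and dilations of Lebesgue measure\<close>

text \<open>Translation is the coordinatewise affine map with all factors equal to 1. The version
  for the completed measure is required because the kernel need not be Borel.\<close>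

lemma nn_integral_lebesgue_translate:
  fixes a :: "'a::euclidean_space"
  assumes "h \<in> borel_measurable lebesgue"
  shows "(\<integral>\<^sup>+x. h (x - a) \<partial>lebesgue) = (\<integral>\<^sup>+x. h x \<partial>lebesgue)"
    and "(\<lambda>x. h (x - a)) \<in> borel_measurable lebesgue"
proof -
  have T: "(\<lambda>x. - a + (\<Sum>j\<in>Basis. (1 * (x \<bullet> j)) *\<^sub>R j)) = (\<lambda>x. x - a)"
    by (simp add: euclidean_representation)
  have meas: "(\<lambda>x. x - a) \<in> lebesgue \<rightarrow>\<^sub>M lebesgue"
    using lebesgue_affine_measurable[of "\<lambda>_. 1" "- a"] unfolding T by simp
  have "lebesgue = distr lebesgue lebesgue (\<lambda>x. x - a)"
    using lebesgue_affine_euclidean[of "\<lambda>_. 1" "- a"] unfolding T by (simp add: density_1)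
  then have "(\<integral>\<^sup>+x. h x \<partial>lebesgue) = (\<integral>\<^sup>+x. h x \<partial>distr lebesgue lebesgue (\<lambda>x. x - a))"
    by simp
  also have "\<dots> = (\<integral>\<^sup>+x. h (x - a) \<partial>lebesgue)"
    using meas assms by (intro nn_integral_distr) auto
  finally show "(\<integral>\<^sup>+x. h (x - a) \<partial>lebesgue) = (\<integral>\<^sup>+x. h x \<partial>lebesgue)" ..
  show "(\<lambda>x. h (x - a)) \<in> borel_measurable lebesgue"
    using meas assms by (rule measurable_compose)
qed

lemma nn_integral_lborel_translate:
  fixes a :: "'a::euclidean_space"
  assumes "h \<in> borel_measurable borel"
  shows "(\<integral>\<^sup>+x. h (x - a) \<partial>lborel) = (\<integral>\<^sup>+x. h x \<partial>lborel)"
  using nn_integral_lebesgue_translate(1)[of h a] assms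
  by (simp add: nn_integral_completion measurable_completion)

text \<open>Dilation is the affine map with constant factor \<open>w\<close>, and the change of
  variables gives \<open>w ^ DIM('a)\<close> times the integral of
  \<open>\<bar>K (w *\<^sub>R x)\<bar>\<close> as the integral of
  \<open>\<bar>K\<bar>\<close>.\<close>

lemma integrable_lebesgue_scaling:
  fixes K :: "'a::euclidean_space \<Rightarrow> real"
  assumes K: "integrable lebesgue K" and w: "w > 0"
  shows "integrable lebesgue (\<lambda>x. K (w *\<^sub>R x))"
proof -
  have T: "(\<lambda>x. 0 + (\<Sum>j\<in>Basis. (w * (x \<bullet> j)) *\<^sub>R j)) = (\<lambda>x::'a. w *\<^sub>R x)"
    by (simp only: scaleR_scaleR[symmetric] scaleR_sum_right[symmetric] euclidean_representation add_0)
  have meas: "(\<lambda>x::'a. w *\<^sub>R x) \<in> lebesgue \<rightarrow>\<^sub>M lebesgue"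
    using lebesgue_affine_measurable[of "\<lambda>_. w" "0 :: 'a"] w unfolding T by simp
  have eq: "lebesgue = density (distr lebesgue lebesgue (\<lambda>x::'a. w *\<^sub>R x)) (\<lambda>_. ennreal (w ^ DIM('a)))"
    using lebesgue_affine_euclidean[of "\<lambda>_. w" "0 :: 'a"] w unfolding T
    by simp
  have Km [measurable]: "(\<lambda>x. ennreal (\<bar>K x\<bar>)) \<in> borel_measurable lebesgue"
    using K by auto
  let ?D = "distr lebesgue lebesgue (\<lambda>x::'a. w *\<^sub>R x)"
  have "(\<integral>\<^sup>+x. ennreal (\<bar>K x\<bar>) \<partial>lebesgue)
      = (\<integral>\<^sup>+x. ennreal (\<bar>K x\<bar>) \<partial>density ?D (\<lambda>_. ennreal (w ^ DIM('a))))"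
    by (rule arg_cong[OF eq])
  also have "\<dots> = (\<integral>\<^sup>+x. ennreal (w ^ DIM('a)) * ennreal (\<bar>K x\<bar>) \<partial>?D)"
    by (rule nn_integral_density) (simp_all add: Km)
  also have "\<dots> = ennreal (w ^ DIM('a)) * (\<integral>\<^sup>+x. ennreal (\<bar>K x\<bar>) \<partial>?D)"
    by (rule nn_integral_cmult) (simp add: Km)
  also have "(\<integral>\<^sup>+x. ennreal (\<bar>K x\<bar>) \<partial>?D) = (\<integral>\<^sup>+x. ennreal (\<bar>K (w *\<^sub>R x)\<bar>) \<partial>lebesgue)"
    by (rule nn_integral_distr[OF meas]) (simp add: Km)
  finally have "ennreal (w ^ DIM('a)) * (\<integral>\<^sup>+x. ennreal (\<bar>K (w *\<^sub>R x)\<bar>) \<partial>lebesgue)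
      = (\<integral>\<^sup>+x. ennreal (\<bar>K x\<bar>) \<partial>lebesgue)" ..
  also have "\<dots> < \<infinity>"
    using K by (simp add: integrable_iff_bounded)
  finally have "ennreal (w ^ DIM('a)) * (\<integral>\<^sup>+x. ennreal (\<bar>K (w *\<^sub>R x)\<bar>) \<partial>lebesgue) < \<infinity>" .
  moreover have "y < \<infinity>" if "ennreal (w ^ DIM('a)) * y < \<infinity>" for y
    using that w by (auto simp: ennreal_mult_less_top)
  ultimately have "(\<integral>\<^sup>+x. ennreal (\<bar>K (w *\<^sub>R x)\<bar>) \<partial>lebesgue) < \<infinity>" by blast
  moreover have "(\<lambda>x. K (w *\<^sub>R x)) \<in> borel_measurable lebesgue"
    by (rule measurable_compose[OF meas borel_measurable_integrable[OF K]])
  ultimately show ?thesis by (intro integrableI_bounded) simp_all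
qed

subsection \<open>Even convex functions and Jensen inequalities\<close>

text \<open>Models \<open>\<phi> \<bar>u\<bar>\<close> as a function on the whole line. Signed
  differences can then be inserted directly, continuity follows from convexity on an open set, and
  supporting lines exist at every point.\<close>

locale even_convex =
  fixes \<Phi> :: "real \<Rightarrow> real"
  assumes convex: "convex_on UNIV \<Phi>"
    and zero [simp]: "\<Phi> 0 = 0"
    and even: "\<Phi> (- u) = \<Phi> u"
    and pos: "u \<noteq> 0 \<Longrightarrow> \<Phi> u > 0"
begin

lemma nonneg [simp]: "0 \<le> \<Phi> u"
  using pos[of u] by (cases "u = 0") auto

lemma borel_measurable [measurable]: "\<Phi> \<in> borel_measurable borel"
  using convex_on_continuous[OF open_UNIV convex] by (rule borel_measurable_continuous_onI)

text \<open>For a factor in \<open>[0, 1]\<close> this is convexity between \<open>0\<close> and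
  \<open>u\<close> together with \<open>\<Phi> 0 = 0\<close>; evenness removes the sign of
  \<open>d\<close>. With \<open>d\<close> the deviation of the node sum from 1, it turns (chi2) into
  a rate for the modular.\<close>

lemma scale_le:
  assumes "\<bar>d\<bar> \<le> D" "D \<le> 1"
  shows "\<Phi> (d * u) \<le> D * \<Phi> u"
proof -
  have *: "\<Phi> (e * v) \<le> e * \<Phi> v" if "0 \<le> e" "e \<le> 1" for e v
    using convex_onD[OF convex, of e 0 v] that by simp
  have "\<Phi> (d * u) = \<Phi> (\<bar>d\<bar> * u)"
    using even[of "d * u"] by (cases "d \<ge> 0") auto
  also have "\<dots> \<le> \<bar>d\<bar> * \<Phi> u"
    using assms by (intro *) auto
  also have "\<dots> \<le> D * \<Phi> u"
    using assms by (intro mult_right_mono) auto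
  finally show ?thesis .
qed

lemma mono_abs:
  assumes "\<bar>u\<bar> \<le> \<bar>v\<bar>"
  shows "\<Phi> u \<le> \<Phi> v"
proof (cases "v = 0")
  case False
  have "\<Phi> ((u / v) * v) \<le> 1 * \<Phi> v"
    using assms False by (intro scale_le) (auto simp: divide_simps)
  then show ?thesis using False by simp
qed (use assms in auto)

text \<open>Midpoint convexity, with the factors 1/2 discarded. Each use doubles the argument, which
  explains the powers of 2 in later constants.\<close>

lemma add_le: "\<Phi> (u + v) \<le> \<Phi> (2 * u) + \<Phi> (2 * v)"
proof -
  have "\<Phi> (u + v) \<le> (1/2) * \<Phi> (2 * u) + (1/2) * \<Phi> (2 * v)"
    using convex_onD[OF convex, of "1 / 2" "2 * u" "2 * v"] by simp
  then show ?thesis using nonneg[of "2 * u"] nonneg[of "2 * v"] by linarith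
qed

text \<open>Convex functions vanishing at 0 grow at least linearly: for
  \<open>\<bar>u\<bar> > 1\<close>, shrinking \<open>u\<close> to modulus 1 by
  \<open>scale_le\<close> gives \<open>\<bar>u\<bar> * \<Phi> 1 \<le> \<Phi> u\<close>. A finite
  modular thus yields integrability on sets of finite measure.\<close>

lemma abs_le: "\<bar>u\<bar> \<le> 1 + \<Phi> u / \<Phi> 1"
proof (cases "\<bar>u\<bar> \<le> 1")
  case True
  moreover have "0 \<le> \<Phi> u / \<Phi> 1" by simp
  ultimately show ?thesis by linarith
next
  case False
  have "\<Phi> ((1 / u) * u) \<le> (1 / \<bar>u\<bar>) * \<Phi> u"
    using False by (intro scale_le) (auto simp: divide_simps)
  then have "\<bar>u\<bar> * \<Phi> 1 \<le> \<Phi> u" using False by (auto simp: field_simps split: if_splits)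
  then show ?thesis using pos[of 1] by (simp add: field_simps)
qed

text \<open>The supporting line of \<open>\<Phi>\<close> at the mean has nonpositive value at \<open>0\<close>, so the missing mass does
  no harm.\<close>

lemma jensen_subprob:
  assumes M: "emeasure M (space M) \<le> 1" and g: "integrable M g"
  shows "ennreal (\<Phi> (\<integral>x. g x \<partial>M)) \<le> (\<integral>\<^sup>+x. ennreal (\<Phi> (g x)) \<partial>M)"
proof (cases "(\<integral>\<^sup>+x. ennreal (\<Phi> (g x)) \<partial>M) = \<infinity>")
  case False
  interpret finite_measure M
    by (rule finite_measureI) (use M in \<open>auto simp: top_unique\<close>)
  have m1: "measure M (space M) \<le> 1"
    using M by (simp add: emeasure_eq_measure)
  have [measurable]: "g \<in> borel_measurable M" using g by auto
  have int: "integrable M (\<lambda>x. \<Phi> (g x))"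
    using False by (intro integrableI_nonneg) (auto simp: top.not_eq_extremum)
  define a where "a = (\<integral>x. g x \<partial>M)"
  obtain s where s: "\<And>y. \<Phi> y \<ge> \<Phi> a + s * (y - a)"
    using convex_le_Inf_differential[OF convex, of a] by auto
  have s0: "\<Phi> a - s * a \<le> 0" using s[of 0] by simp
  have "\<Phi> a \<le> (\<Phi> a - s * a) * measure M (space M) + s * a"
    using mult_left_mono_neg[OF m1 s0] by simp
  also have "\<dots> = (\<integral>x. (\<Phi> a - s * a) + s * g x \<partial>M)"
    using g by (simp add: a_def)
  also have "\<dots> \<le> (\<integral>x. \<Phi> (g x) \<partial>M)"
  proof (rule integral_mono)
    fix x
    show "\<Phi> a - s * a + s * g x \<le> \<Phi> (g x)"
      using s[of "g x"] by (simp add: algebra_simps)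
  qed (use g int in auto)
  finally show ?thesis
    using int by (subst nn_integral_eq_integral) (auto simp: a_def intro: ennreal_leI)
qed auto

text \<open>The weights \<open>\<bar>a k\<bar> / m\<close> have total mass at most 1. Writing
  \<open>a k * g k\<close> as this weight times \<open>sgn (a k) * (m * g k)\<close> moves sign and
  normalisation into the argument of \<open>\<Phi>\<close>, where \<open>mono_abs\<close> discards
  the sign.\<close>

lemma jensen_infsum:
  fixes a g :: "'k \<Rightarrow> real"
  assumes m: "m > 0" and a: "(\<integral>\<^sup>+k. ennreal \<bar>a k\<bar> \<partial>count_space UNIV) \<le> ennreal m"
    and g: "\<And>k. \<bar>g k\<bar> \<le> B"
  shows "ennreal (\<Phi> (\<Sum>\<^sub>\<infinity>k\<in>UNIV. a k * g k))
    \<le> (\<integral>\<^sup>+k. ennreal (\<bar>a k\<bar> / m) * ennreal (\<Phi> (m * g k)) \<partial>count_space UNIV)"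
proof -
  let ?M = "density (count_space UNIV) (\<lambda>k. ennreal (\<bar>a k\<bar> / m))"
  have ag_int: "integrable (count_space UNIV) (\<lambda>k. a k * g k)"
    using a by (intro mult_bounded_count_space(1)[OF _ g]) (simp add: le_less_trans)
  have eq: "(\<lambda>k. (\<bar>a k\<bar> / m) *\<^sub>R (sgn (a k) * (m * g k))) = (\<lambda>k. a k * g k)"
    using m by (auto simp: sgn_if)
  have "(\<Sum>\<^sub>\<infinity>k\<in>UNIV. a k * g k) = (\<integral>k. a k * g k \<partial>count_space UNIV)"
    using ag_int by (simp add: infsetsum_infsum[symmetric] infsetsum_def abs_summable_on_def)
  also have "\<dots> = (\<integral>k. sgn (a k) * (m * g k) \<partial>?M)"
    using m by (subst integral_density) (auto simp: sgn_if intro!: Bochner_Integration.integral_cong)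
  finally have 1: "(\<Sum>\<^sub>\<infinity>k\<in>UNIV. a k * g k) = (\<integral>k. sgn (a k) * (m * g k) \<partial>?M)" .
  have "ennreal (\<Phi> (\<integral>k. sgn (a k) * (m * g k) \<partial>?M))
      \<le> (\<integral>\<^sup>+k. ennreal (\<Phi> (sgn (a k) * (m * g k))) \<partial>?M)"
  proof (rule jensen_subprob)
    have "emeasure ?M (space ?M) = (\<integral>\<^sup>+k. ennreal (1 / m) * ennreal \<bar>a k\<bar> \<partial>count_space UNIV)"
      using m by (simp add: emeasure_density ennreal_mult[symmetric])
    also have "\<dots> = ennreal (1 / m) * (\<integral>\<^sup>+k. ennreal \<bar>a k\<bar> \<partial>count_space UNIV)"
      by (rule nn_integral_cmult) auto
    also have "\<dots> \<le> ennreal (1 / m) * ennreal m"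
      using a by (rule mult_left_mono) auto
    also have "\<dots> = 1" using m by (simp add: ennreal_mult[symmetric])
    finally show "emeasure ?M (space ?M) \<le> 1" .
    show "integrable ?M (\<lambda>k. sgn (a k) * (m * g k))"
      using m ag_int by (subst integrable_density) (auto simp only: eq AE_count_space, auto)
  qed
  also have "\<dots> = (\<integral>\<^sup>+k. ennreal (\<bar>a k\<bar> / m) * ennreal (\<Phi> (sgn (a k) * (m * g k))) \<partial>count_space UNIV)"
    by (subst nn_integral_density) auto
  also have "\<dots> \<le> (\<integral>\<^sup>+k. ennreal (\<bar>a k\<bar> / m) * ennreal (\<Phi> (m * g k)) \<partial>count_space UNIV)"
    by (intro nn_integral_mono mult_left_mono ennreal_leI mono_abs) (auto simp: abs_mult sgn_if)
  finally show ?thesis unfolding 1 .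
qed

text \<open>The density \<open>W * indicator S\<close> has mass at most 1, so
  \<open>jensen_subprob\<close> applies to it.\<close>

lemma jensen_average:
  fixes g :: "'a::euclidean_space \<Rightarrow> real"
  assumes S: "S \<in> sets lborel" and W: "W \<ge> 0" "emeasure lborel S * ennreal W \<le> 1"
    and g: "set_integrable lborel S g"
  shows "ennreal (\<Phi> (W * (LINT u:S|lborel. g u)))
    \<le> (\<integral>\<^sup>+u. ennreal W * indicator S u * ennreal (\<Phi> (g u)) \<partial>lborel)"
proof -
  let ?M = "density lborel (\<lambda>u. ennreal (W * indicator S u))"
  have [measurable]: "S \<in> sets borel" using S by simp
  have g': "integrable lborel (\<lambda>u. W * (indicator S u * g u))"
    using g by (auto simp: set_integrable_def)
  have e: "(\<lambda>u. (W * indicator S u) *\<^sub>R (indicator S u * g u)) = (\<lambda>u. W * (indicator S u * g u))"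
    by (auto simp: indicator_def)
  have [measurable]: "(\<lambda>u. indicator S u * g u) \<in> borel_measurable borel"
    using g by (auto simp: set_integrable_def dest: borel_measurable_integrable)
  have 1: "W * (LINT u:S|lborel. g u) = (\<integral>u. indicator S u * g u \<partial>?M)"
    using W(1) by (subst integral_density) (simp_all only: e, auto simp: set_lebesgue_integral_def)
  have "ennreal (\<Phi> (\<integral>u. indicator S u * g u \<partial>?M))
      \<le> (\<integral>\<^sup>+u. ennreal (\<Phi> (indicator S u * g u)) \<partial>?M)"
  proof (rule jensen_subprob)
    have "emeasure ?M (space ?M) = (\<integral>\<^sup>+u. ennreal W * indicator S u \<partial>lborel)"
      using W(1) by (auto simp: emeasure_density intro!: nn_integral_cong split: split_indicator)
    also have "\<dots> \<le> 1" using W(2) S by (simp add: nn_integral_cmult mult.commute)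
    finally show "emeasure ?M (space ?M) \<le> 1" .
    show "integrable ?M (\<lambda>u. indicator S u * g u)"
      using W(1) g' by (subst integrable_density) (simp_all only: e, auto)
  qed
  also have "\<dots> = (\<integral>\<^sup>+u. ennreal (W * indicator S u) * ennreal (\<Phi> (indicator S u * g u)) \<partial>lborel)"
    using W(1) by (subst nn_integral_density) auto
  also have "\<dots> = (\<integral>\<^sup>+u. ennreal W * indicator S u * ennreal (\<Phi> (g u)) \<partial>lborel)"
    by (intro nn_integral_cong) (auto split: split_indicator)
  finally show ?thesis unfolding 1 .
qed

text \<open>Integrate \<open>abs_le\<close> for \<open>l * f\<close> over \<open>S\<close> with
  weight \<open>W\<close>. Since \<open>W\<close> is the reciprocal of the measure of
  \<open>S\<close>, the constant term contributes \<open>1 / l\<close>, and the rest is controlled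
  by the modular. The common bound \<open>W'\<close> makes the estimate uniform over all
  cells.\<close>

lemma average_bound:
  fixes f :: "'a::euclidean_space \<Rightarrow> real"
  assumes [measurable]: "f \<in> borel_measurable borel" "S \<in> sets borel"
    and l: "l > 0" and I: "(\<integral>\<^sup>+x. ennreal (\<Phi> (l * f x)) \<partial>lborel) \<le> ennreal I" "I \<ge> 0"
    and W: "emeasure lborel S * ennreal W = 1" "0 \<le> W" "W \<le> W'"
  shows "set_integrable lborel S f" "\<bar>W * (LINT u:S|lborel. f u)\<bar> \<le> (1 + W' * (I / \<Phi> 1)) / l"
proof -
  have "\<Phi> 1 > 0" by (rule pos) simp
  let ?h = "\<lambda>u. indicator S u * f u"
  have "ennreal (W * norm (?h u))
      \<le> ennreal (W / l) * indicator S u + ennreal (W / (l * \<Phi> 1)) * ennreal (\<Phi> (l * f u))" for u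
  proof (cases "u \<in> S")
    case True
    have "l * \<bar>f u\<bar> \<le> 1 + \<Phi> (l * f u) / \<Phi> 1"
      using abs_le[of "l * f u"] l by (simp add: abs_mult)
    then have "\<bar>f u\<bar> \<le> (1 + \<Phi> (l * f u) / \<Phi> 1) / l"
      using l by (simp add: field_simps)
    then have "W * \<bar>f u\<bar> \<le> W * ((1 + \<Phi> (l * f u) / \<Phi> 1) / l)"
      using W(2) by (rule mult_left_mono)
    also have "\<dots> = W / l + W / (l * \<Phi> 1) * \<Phi> (l * f u)"
      using l \<open>\<Phi> 1 > 0\<close> by (simp add: field_simps)
    finally have "ennreal (W * \<bar>f u\<bar>) \<le> ennreal (W / l + W / (l * \<Phi> 1) * \<Phi> (l * f u))"
      by (rule ennreal_leI)
    also have "\<dots> = ennreal (W / l) + ennreal (W / (l * \<Phi> 1)) * ennreal (\<Phi> (l * f u))"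
      using l \<open>\<Phi> 1 > 0\<close> W(2) by (subst ennreal_plus) (auto simp flip: ennreal_mult)
    finally show ?thesis using True by simp
  qed auto
  then have "(\<integral>\<^sup>+u. ennreal (W * norm (?h u)) \<partial>lborel)
      \<le> (\<integral>\<^sup>+u. ennreal (W / l) * indicator S u + ennreal (W / (l * \<Phi> 1)) * ennreal (\<Phi> (l * f u)) \<partial>lborel)"
    by (intro nn_integral_mono)
  also have "\<dots> = ennreal (W / l) * emeasure lborel S
      + ennreal (W / (l * \<Phi> 1)) * (\<integral>\<^sup>+u. ennreal (\<Phi> (l * f u)) \<partial>lborel)"
    by (simp add: nn_integral_add nn_integral_cmult)
  also have "ennreal (W / l) * emeasure lborel S = ennreal (1 / l) * (emeasure lborel S * ennreal W)"
    using W(2) l ennreal_mult[of "1 / l" W] by (simp add: mult_ac)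
  also have "\<dots> = ennreal (1 / l)" by (simp add: W(1))
  also have "ennreal (1 / l) + ennreal (W / (l * \<Phi> 1)) * (\<integral>\<^sup>+u. ennreal (\<Phi> (l * f u)) \<partial>lborel)
      \<le> ennreal (1 / l) + ennreal (W' / (l * \<Phi> 1)) * ennreal I"
    using I(1) W l \<open>\<Phi> 1 > 0\<close>
    by (intro add_left_mono mult_mono ennreal_leI divide_right_mono) auto
  also have "\<dots> = ennreal ((1 + W' * (I / \<Phi> 1)) / l)"
    using l I W \<open>\<Phi> 1 > 0\<close>
    by (simp add: ennreal_mult[symmetric] ennreal_plus[symmetric] add_divide_distrib mult_ac del: ennreal_plus)
  finally have *: "(\<integral>\<^sup>+u. ennreal (W * norm (?h u)) \<partial>lborel) \<le> ennreal ((1 + W' * (I / \<Phi> 1)) / l)" .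
  have "W \<noteq> 0" using W(1) by auto
  have "(\<integral>\<^sup>+u. ennreal (norm (W * ?h u)) \<partial>lborel) < \<infinity>"
    using W(2) * by (simp add: abs_mult le_less_trans)
  then have int: "integrable lborel (\<lambda>u. W * ?h u)"
    by (intro integrableI_bounded) auto
  then show "set_integrable lborel S f"
    using \<open>W \<noteq> 0\<close> by (simp add: set_integrable_def)
  have "ennreal (norm (\<integral>u. W * ?h u \<partial>lborel)) \<le> ennreal ((1 + W' * (I / \<Phi> 1)) / l)"
    using integral_norm_bound_ennreal[OF int] W(2) * by (simp add: abs_mult)
  then have "norm (\<integral>u. W * ?h u \<partial>lborel) \<le> (1 + W' * (I / \<Phi> 1)) / l"
    using l I W by (subst (asm) ennreal_le_iff) auto
  then show "\<bar>W * (LINT u:S|lborel. f u)\<bar> \<le> (1 + W' * (I / \<Phi> 1)) / l"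
    by (simp add: set_lebesgue_integral_def)
qed

end

text \<open>Convexity survives composition with the absolute value because \<open>\<phi>\<close> is
  nondecreasing: apply the triangle inequality first, then convexity on the half-line.\<close>

lemma even_convex_abs:
  assumes "phi_function \<phi>" "convex_on {0..} \<phi>"
  shows "even_convex (\<lambda>u. \<phi> \<bar>u\<bar>)"
proof
  have mono: "\<phi> u \<le> \<phi> v" if "0 \<le> u" "u \<le> v" for u v
    using assms that by (auto simp: phi_function_def mono_on_def)
  show "convex_on UNIV (\<lambda>u. \<phi> \<bar>u\<bar>)"
  proof (rule convex_onI)
    fix e x y :: real assume e: "0 < e" "e < 1"
    have "\<bar>(1 - e) *\<^sub>R x + e *\<^sub>R y\<bar> \<le> \<bar>(1 - e) * x\<bar> + \<bar>e * y\<bar>"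
      by simp
    also have "\<dots> = (1 - e) * \<bar>x\<bar> + e * \<bar>y\<bar>"
      using e by (simp add: abs_mult)
    finally have "\<phi> \<bar>(1 - e) *\<^sub>R x + e *\<^sub>R y\<bar> \<le> \<phi> ((1 - e) *\<^sub>R \<bar>x\<bar> + e *\<^sub>R \<bar>y\<bar>)"
      by (intro mono) auto
    also have "\<dots> \<le> (1 - e) * \<phi> \<bar>x\<bar> + e * \<phi> \<bar>y\<bar>"
      using e by (intro convex_onD[OF assms(2)]) auto
    finally show "\<phi> \<bar>(1 - e) *\<^sub>R x + e *\<^sub>R y\<bar> \<le> (1 - e) * \<phi> \<bar>x\<bar> + e * \<phi> \<bar>y\<bar>" .
  qed auto
qed (use assms in \<open>auto simp: phi_function_def\<close>)

subsection \<open>Sampling nodes and cells\<close>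

text \<open>Fixes witnesses for the gap bounds in \<open>sampling_nodes\<close>, so that later
  constants are explicit in \<open>\<delta>\<close> and \<open>\<Delta>\<close>.\<close>

locale spaced_nodes =
  fixes t :: "'n::finite \<Rightarrow> int \<Rightarrow> real" and \<delta> \<Delta> :: real
  assumes \<delta>: "\<delta> > 0" and \<Delta>: "\<Delta> > 0"
    and gap: "\<delta> \<le> t i (k + 1) - t i k" "t i (k + 1) - t i k \<le> \<Delta>"
begin

lemma gap_ge:
  assumes "j \<le> j'"
  shows "\<delta> * (of_int j' - of_int j) \<le> t i j' - t i j"
  using assms
proof (induction j' rule: int_ge_induct)
  case (step j')
  then show ?case using gap(1)[of i j'] by (simp add: algebra_simps)
qed simp

lemma index_dist_le: "\<delta> * \<bar>of_int j' - of_int j\<bar> \<le> \<bar>t i j' - t i j\<bar>"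
proof (cases "j \<le> j'")
  case True
  then show ?thesis using gap_ge[of j j' i] by simp
next
  case False
  then show ?thesis using gap_ge[of j' j i] by simp
qed

text \<open>Two nodes in the same cube differ by at most \<open>2 * \<rho>\<close> in each
  coordinate, so by \<open>index_dist_le\<close> their indices differ by at most \<open>Z\<close>.
  Subtracting one fixed index injects the set into the finite box \<open>D\<close>, whose size does
  not depend on \<open>u\<close>.\<close>

lemma nodes_in_cube:
  obtains N :: nat where "N > 0"
    "\<And>u. finite {k. \<forall>i. \<bar>t i (k $ i) - u $ i\<bar> \<le> \<rho>}"
    "\<And>u. card {k. \<forall>i. \<bar>t i (k $ i) - u $ i\<bar> \<le> \<rho>} \<le> N"
proof -
  define Z where "Z = \<lceil>2 * \<rho> / \<delta>\<rceil>"
  define D where "D = {d :: int ^ 'n. \<forall>i. d $ i \<in> {-Z..Z}}"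
  have "D \<subseteq> vec_lambda ` (PiE UNIV (\<lambda>_. {-Z..Z}))"
  proof
    fix d assume "d \<in> D"
    then have "d = vec_lambda (vec_nth d)" "vec_nth d \<in> PiE UNIV (\<lambda>_. {-Z..Z})"
      by (auto simp: D_def)
    then show "d \<in> vec_lambda ` (PiE UNIV (\<lambda>_. {-Z..Z}))" by (rule image_eqI)
  qed
  then have fin: "finite D"
    by (rule finite_subset) (auto intro!: finite_imageI finite_PiE)
  have *: "finite S \<and> card S \<le> card D" if S: "S = {k. \<forall>i. \<bar>t i (k $ i) - u $ i\<bar> \<le> \<rho>}" for u S
  proof (cases "S = {}")
    case False
    then obtain k0 where k0: "k0 \<in> S" by blast
    have "(\<lambda>k. k - k0) ` S \<subseteq> D"
    proof safe
      fix k assume k: "k \<in> S"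
      show "k - k0 \<in> D"
        unfolding D_def
      proof safe
        fix i
        have "\<delta> * \<bar>of_int (k $ i) - of_int (k0 $ i)\<bar> \<le> \<bar>t i (k $ i) - t i (k0 $ i)\<bar>"
          by (rule index_dist_le)
        also have "\<dots> \<le> 2 * \<rho>"
        proof -
          have "\<bar>t i (k $ i) - u $ i\<bar> \<le> \<rho>" "\<bar>t i (k0 $ i) - u $ i\<bar> \<le> \<rho>"
            using k k0 by (auto simp: S)
          then show ?thesis by linarith
        qed
        finally have "\<bar>of_int (k $ i) - of_int (k0 $ i)\<bar> \<le> 2 * \<rho> / \<delta>"
          using \<delta> by (simp add: field_simps)
        also have "\<dots> \<le> of_int Z" by (simp add: Z_def)
        finally have "\<bar>k $ i - k0 $ i\<bar> \<le> Z" by linarith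
        then show "(k - k0) $ i \<in> {-Z..Z}" by auto
      qed
    qed
    moreover have "inj_on (\<lambda>k. k - k0) S" by (auto intro: inj_onI)
    ultimately show ?thesis
      using fin card_inj_on_le inj_on_finite by blast
  qed auto
  \<comment> \<open>The successor keeps the bound positive even when \<open>D\<close> is empty,
    which can happen for negative \<open>\<rho>\<close>.\<close>
  show thesis
    using * by (intro that[of "Suc (card D)"]) (auto simp: le_Suc_eq)
qed

section \<open>Measure, offset and overlap of the scaled cells\<close>

lemma cell_volume_ge: "\<delta> ^ CARD('n) \<le> cell_volume t k"
  unfolding cell_volume_def
  using prod_mono[of UNIV "\<lambda>_. \<delta>" "\<lambda>i. t i (k $ i + 1) - t i (k $ i)"] \<delta> gap by simp

lemma cell_volume_pos: "0 < cell_volume t k"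
  using cell_volume_ge[of k] \<delta> by (meson less_le_trans zero_less_power)

text \<open>By the product formula for boxes, the prefactor in \<open>kantorovich\<close> is the
  reciprocal of the measure of the cell. The operator therefore uses genuine mean values, to which
  Jensen applies.\<close>

lemma emeasure_cell:
  assumes "w > 0"
  shows "emeasure lborel (cell t w k) * ennreal (w ^ CARD('n) / cell_volume t k) = 1"
proof -
  have le: "t i (k $ i) \<le> t i (k $ i + 1)" for i
    using gap(1)[of i "k $ i"] \<delta> by linarith
  have "cell t w k \<noteq> {}"
    using le assms unfolding cell_def
    by (auto simp: interval_ne_empty_cart intro!: divide_right_mono)
  moreover have "emeasure lborel (cell t w k) \<noteq> \<infinity>"
    unfolding cell_def using emeasure_lborel_cbox_finite by (simp add: less_top)
  ultimately have "emeasure lborel (cell t w k) = ennreal (cell_volume t k / w ^ CARD('n))"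
    by (subst emeasure_eq_ennreal_measure)
       (auto simp: cell_def content_cbox_cart cell_volume_def prod_dividef diff_divide_distrib[symmetric])
  then show ?thesis
    using assms cell_volume_pos[of k] by (simp add: ennreal_mult[symmetric])
qed

lemma cell_weight_le:
  assumes "w > 0"
  shows "w ^ CARD('n) / cell_volume t k \<le> (w / \<delta>) ^ CARD('n)"
  unfolding power_divide using cell_volume_ge[of k] cell_volume_pos[of k] assms \<delta>
  by (intro divide_left_mono) auto

text \<open>The scaled node is the lower corner of its cell, and the sides have length at most
  \<open>\<Delta> / w\<close>. The cube on the right is the same for every \<open>k\<close>, so all
  cells can be compared with one domain of shifts.\<close>

lemma cell_offset:
  assumes "w > 0" "u \<in> cell t w k"
  shows "u - node t k /\<^sub>R w \<in> cbox 0 (\<chi> i. \<Delta> / w)"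
proof -
  have "u $ i - t i (k $ i) / w \<le> \<Delta> / w" if "u $ i \<le> t i (k $ i + 1) / w" for i
  proof -
    have "t i (k $ i + 1) / w - t i (k $ i) / w \<le> \<Delta> / w"
      using gap(2)[of i "k $ i"] assms(1) by (simp add: diff_divide_distrib[symmetric] divide_right_mono)
    then show ?thesis using that by linarith
  qed
  then show ?thesis
    using assms by (auto simp: cell_def mem_box_cart node_def divide_inverse mult.commute)
qed

text \<open>A point \<open>u\<close> of a cell has \<open>w *\<^sub>R u\<close> within
  \<open>\<Delta>\<close> of the node in each coordinate, so \<open>nodes_in_cube\<close> counts the
  cells containing \<open>u\<close>. Rescaling makes \<open>N\<close> independent of
  \<open>w\<close>. Closed cells share faces; bounded overlap avoids treating these
  separately.\<close>

lemma cell_overlap: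
  obtains N :: nat where
    "\<And>w u. w > 0 \<Longrightarrow> (\<integral>\<^sup>+k. indicator (cell t w k) u \<partial>count_space UNIV) \<le> of_nat N"
proof -
  obtain N :: nat where N: "N > 0"
    "\<And>u. finite {k. \<forall>i. \<bar>t i (k $ i) - u $ i\<bar> \<le> \<Delta>}"
    "\<And>u. card {k. \<forall>i. \<bar>t i (k $ i) - u $ i\<bar> \<le> \<Delta>} \<le> N"
    by (rule nodes_in_cube[where \<rho> = \<Delta>]) blast
  have "(\<integral>\<^sup>+k. indicator (cell t w k) u \<partial>count_space UNIV) \<le> of_nat N" if "w > 0" for w u
  proof -
    let ?S = "{k. \<forall>i. \<bar>t i (k $ i) - (w *\<^sub>R u) $ i\<bar> \<le> \<Delta>}"
    have "k \<in> ?S" if k: "u \<in> cell t w k" for k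
    proof safe
      fix i
      have "t i (k $ i) \<le> w * u $ i" "w * u $ i \<le> t i (k $ i + 1)"
        using k \<open>w > 0\<close> by (auto simp: cell_def mem_box_cart field_simps)
      then show "\<bar>t i (k $ i) - (w *\<^sub>R u) $ i\<bar> \<le> \<Delta>"
        using gap(2)[of i "k $ i"] by simp
    qed
    then have "(\<integral>\<^sup>+k. indicator (cell t w k) u \<partial>count_space UNIV)
        \<le> (\<integral>\<^sup>+k. indicator ?S k \<partial>count_space UNIV)"
      by (intro nn_integral_mono) (auto split: split_indicator)
    also have "\<dots> = of_nat (card ?S)"
      using N(2)[of "w *\<^sub>R u"] by simp
    also have "\<dots> \<le> of_nat N" using N(3)[of "w *\<^sub>R u"] by (rule of_nat_mono)
    finally show ?thesis .
  qed
  then show thesis by (rule that)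
qed

text \<open>Split by distance of the node from \<open>u\<close>. Fewer than \<open>r\<close> away,
  there are boundedly many nodes and \<open>K\<close> is bounded by (chi1); farther away, inserting
  \<open>(norm (u - node t k) / r) powr \<beta> \<ge> 1\<close> reduces the sum to the moment in
  (chi3).\<close>

lemma abs_node_sum_bounded:
  assumes K: "bounded (K ` ball 0 r)" "r > 0" and \<beta>: "abs_moment t K \<beta> < \<infinity>"
    and pos: "\<beta> > 0"
  obtains m where "m > 0"
    "\<And>u. (\<integral>\<^sup>+k. ennreal \<bar>K (u - node t k)\<bar> \<partial>count_space UNIV) \<le> ennreal m"
proof -
  obtain B where B: "B > 0" "\<And>x. x \<in> ball 0 r \<Longrightarrow> \<bar>K x\<bar> \<le> B"
    using K(1) by (auto simp: bounded_pos)
  obtain N :: nat where N: "N > 0"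
    "\<And>u. finite {k. \<forall>i. \<bar>t i (k $ i) - u $ i\<bar> \<le> r}"
    "\<And>u. card {k. \<forall>i. \<bar>t i (k $ i) - u $ i\<bar> \<le> r} \<le> N"
    by (rule nodes_in_cube[where \<rho> = r]) blast
  obtain A where A: "A \<ge> 0" "abs_moment t K \<beta> = ennreal A"
    using \<beta> by (cases "abs_moment t K \<beta>") auto
  let ?f = "\<lambda>u k. ennreal (\<bar>K (u - node t k)\<bar> * norm (u - node t k) powr \<beta>)"
  have "(\<integral>\<^sup>+k. ennreal \<bar>K (u - node t k)\<bar> \<partial>count_space UNIV)
      \<le> ennreal (B * N + A / r powr \<beta>)" for u
  proof -
    let ?S = "{k. \<forall>i. \<bar>t i (k $ i) - u $ i\<bar> \<le> r}"
    have le: "ennreal \<bar>K (u - node t k)\<bar>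
        \<le> ennreal B * indicator ?S k + ennreal (1 / r powr \<beta>) * ?f u k" for k
    proof (cases "norm (u - node t k) < r")
      case True
      have "k \<in> ?S"
      proof safe
        fix i
        show "\<bar>t i (k $ i) - u $ i\<bar> \<le> r"
          using True component_le_norm_cart[of "u - node t k" i] by (simp add: node_def)
      qed
      moreover have "ennreal \<bar>K (u - node t k)\<bar> \<le> ennreal B"
        using True B by (intro ennreal_leI) auto
      ultimately show ?thesis by (simp add: add_increasing2)
    next
      case False
      have "r powr \<beta> \<le> norm (u - node t k) powr \<beta>"
        using False pos K(2) by (intro powr_mono2) auto
      then have "\<bar>K (u - node t k)\<bar> * r powr \<beta> \<le> \<bar>K (u - node t k)\<bar> * norm (u - node t k) powr \<beta>"
        by (intro mult_left_mono) auto
      then have "\<bar>K (u - node t k)\<bar> \<le> 1 / r powr \<beta> * (\<bar>K (u - node t k)\<bar> * norm (u - node t k) powr \<beta>)"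
        using K(2) by (simp add: field_simps)
      then have "ennreal \<bar>K (u - node t k)\<bar> \<le> ennreal (1 / r powr \<beta>) * ?f u k"
        by (subst ennreal_mult[symmetric]) (auto intro: ennreal_leI)
      then show ?thesis by (simp add: add_increasing)
    qed
    have "(\<integral>\<^sup>+k. ennreal \<bar>K (u - node t k)\<bar> \<partial>count_space UNIV)
        \<le> (\<integral>\<^sup>+k. ennreal B * indicator ?S k + ennreal (1 / r powr \<beta>) * ?f u k \<partial>count_space UNIV)"
      by (intro nn_integral_mono le)
    also have "\<dots> = ennreal B * of_nat (card ?S)
        + ennreal (1 / r powr \<beta>) * (\<integral>\<^sup>+k. ?f u k \<partial>count_space UNIV)"
      using N(2)[of u] by (simp add: nn_integral_add nn_integral_cmult)
    also have "\<dots> \<le> ennreal B * of_nat N + ennreal (1 / r powr \<beta>) * ennreal A"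
    proof (intro add_mono mult_left_mono)
      have "(\<integral>\<^sup>+k. ?f u k \<partial>count_space UNIV) \<le> (\<Sum>\<^sub>\<infinity>k\<in>UNIV. ?f u k)"
        by (rule nn_integral_count_space_le_infsum)
      also have "\<dots> \<le> ennreal A"
        unfolding A(2)[symmetric] abs_moment_def by (rule SUP_upper) simp
      finally show "(\<integral>\<^sup>+k. ?f u k \<partial>count_space UNIV) \<le> ennreal A" .
    qed (use N(3)[of u] in \<open>auto intro: of_nat_mono\<close>)
    also have "\<dots> = ennreal (B * N + A / r powr \<beta>)"
      using B(1) A(1) by (simp add: ennreal_mult[symmetric] ennreal_plus[symmetric] ennreal_of_nat_eq_real_of_nat del: ennreal_plus)
    finally show ?thesis .
  qed
  moreover have "B * N + A / r powr \<beta> > 0"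
    using B(1) A(1) N(1) by (intro add_pos_nonneg) auto
  ultimately show thesis using that by blast
qed

section \<open>Exchanging the sum over cells with integration\<close>

lemma cell_borel [measurable]: "cell t w k \<in> sets borel"
  by (simp add: cell_def)

text \<open>Tonelli and translation by the scaled node turn \<open>x - node t k /\<^sub>R w\<close>
  into a variable \<open>y\<close> free of \<open>k\<close>. Then \<open>k\<close> occurs only in
  the indicator of the cell, and the overlap bound \<open>N\<close> sums it. This serves the half of
  the error in which \<open>f\<close> at \<open>u\<close> is shifted by
  \<open>x - node t k /\<^sub>R w\<close>.\<close>

lemma nn_integral_node_shift_le:
  fixes h :: "real ^ 'n \<Rightarrow> ennreal" and H :: "real ^ 'n \<Rightarrow> real ^ 'n \<Rightarrow> ennreal"
  assumes h: "h \<in> borel_measurable lebesgue"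
    and H [measurable]: "(\<lambda>(u, y). H u y) \<in> borel_measurable (borel \<Otimes>\<^sub>M borel)"
    and N: "\<And>u. (\<integral>\<^sup>+k. indicator (cell t w k) u \<partial>count_space UNIV) \<le> of_nat N"
  shows "(\<integral>\<^sup>+x. \<integral>\<^sup>+k. h (x - node t k /\<^sub>R w) *
        (\<integral>\<^sup>+u. indicator (cell t w k) u * H u (x - node t k /\<^sub>R w) \<partial>lborel) \<partial>count_space UNIV \<partial>lebesgue)
    \<le> of_nat N * (\<integral>\<^sup>+y. h y * (\<integral>\<^sup>+u. H u y \<partial>lborel) \<partial>lebesgue)"
proof -
  define G where "G = (\<lambda>k y. h y * (\<integral>\<^sup>+u. indicator (cell t w k) u * H u y \<partial>lborel))"
  have [measurable]: "(\<lambda>y. \<integral>\<^sup>+u. indicator (cell t w k) u * H u y \<partial>lborel) \<in> borel_measurable borel" for k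
    by measurable
  have [measurable]: "(\<lambda>y. \<integral>\<^sup>+u. H u y \<partial>lborel) \<in> borel_measurable borel"
    by measurable
  have G: "G k \<in> borel_measurable lebesgue" for k
    unfolding G_def using h
    by (intro borel_measurable_times_ennreal) (auto intro!: measurable_completion)
  have "(\<integral>\<^sup>+x. \<integral>\<^sup>+k. G k (x - node t k /\<^sub>R w) \<partial>count_space UNIV \<partial>lebesgue)
      = (\<integral>\<^sup>+k. \<integral>\<^sup>+x. G k (x - node t k /\<^sub>R w) \<partial>lebesgue \<partial>count_space UNIV)"
    by (intro nn_integral_count_space_nn_integral nn_integral_lebesgue_translate(2) G) auto
  also have "\<dots> = (\<integral>\<^sup>+k. \<integral>\<^sup>+y. G k y \<partial>lebesgue \<partial>count_space UNIV)"
    by (simp add: nn_integral_lebesgue_translate(1)[OF G])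
  also have "\<dots> = (\<integral>\<^sup>+y. \<integral>\<^sup>+k. G k y \<partial>count_space UNIV \<partial>lebesgue)"
    by (intro nn_integral_count_space_nn_integral[symmetric] G) auto
  also have "\<dots> \<le> (\<integral>\<^sup>+y. of_nat N * (h y * (\<integral>\<^sup>+u. H u y \<partial>lborel)) \<partial>lebesgue)"
  proof (rule nn_integral_mono)
    fix y
    have "(\<integral>\<^sup>+k. \<integral>\<^sup>+u. indicator (cell t w k) u * H u y \<partial>lborel \<partial>count_space UNIV)
        = (\<integral>\<^sup>+u. \<integral>\<^sup>+k. indicator (cell t w k) u * H u y \<partial>count_space UNIV \<partial>lborel)"
      by (intro nn_integral_count_space_nn_integral[symmetric]) auto
    also have "\<dots> = (\<integral>\<^sup>+u. (\<integral>\<^sup>+k. indicator (cell t w k) u \<partial>count_space UNIV) * H u y \<partial>lborel)"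
      by (intro nn_integral_cong nn_integral_multc) auto
    also have "\<dots> \<le> (\<integral>\<^sup>+u. of_nat N * H u y \<partial>lborel)"
      by (intro nn_integral_mono mult_right_mono N) auto
    also have "\<dots> = of_nat N * (\<integral>\<^sup>+u. H u y \<partial>lborel)"
      by (intro nn_integral_cmult) auto
    finally have le: "(\<integral>\<^sup>+k. \<integral>\<^sup>+u. indicator (cell t w k) u * H u y \<partial>lborel \<partial>count_space UNIV)
        \<le> of_nat N * (\<integral>\<^sup>+u. H u y \<partial>lborel)" .
    have "(\<integral>\<^sup>+k. G k y \<partial>count_space UNIV)
        = h y * (\<integral>\<^sup>+k. \<integral>\<^sup>+u. indicator (cell t w k) u * H u y \<partial>lborel \<partial>count_space UNIV)"
      unfolding G_def by (rule nn_integral_cmult) auto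
    also have "\<dots> \<le> h y * (of_nat N * (\<integral>\<^sup>+u. H u y \<partial>lborel))"
      by (intro mult_left_mono le) auto
    finally show "(\<integral>\<^sup>+k. G k y \<partial>count_space UNIV) \<le> of_nat N * (h y * (\<integral>\<^sup>+u. H u y \<partial>lborel))"
      by (simp add: mult_ac)
  qed
  also have "\<dots> = of_nat N * (\<integral>\<^sup>+y. h y * (\<integral>\<^sup>+u. H u y \<partial>lborel) \<partial>lebesgue)"
    using h by (intro nn_integral_cmult borel_measurable_times_ennreal) (auto intro!: measurable_completion)
  finally show ?thesis unfolding G_def .
qed

text \<open>Here the substitution is in the cell variable: by \<open>cell_offset\<close> the inner
  integral is at most an integral over one small cube, independent of \<open>k\<close>. The
  remaining sum of \<open>h\<close> is bounded by \<open>m\<close>, and Fubini brings the integral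
  in \<open>x\<close> inside.\<close>

lemma nn_integral_cell_shift_le:
  fixes h :: "real ^ 'n \<Rightarrow> ennreal" and D :: "real ^ 'n \<Rightarrow> real ^ 'n \<Rightarrow> ennreal"
  assumes w: "w > 0"
    and D [measurable]: "(\<lambda>(v, x). D v x) \<in> borel_measurable (borel \<Otimes>\<^sub>M borel)"
    and m: "\<And>x. (\<integral>\<^sup>+k. h (x - node t k /\<^sub>R w) \<partial>count_space UNIV) \<le> m"
  shows "(\<integral>\<^sup>+x. \<integral>\<^sup>+k. h (x - node t k /\<^sub>R w) *
        (\<integral>\<^sup>+u. indicator (cell t w k) u * D (u - node t k /\<^sub>R w) x \<partial>lborel) \<partial>count_space UNIV \<partial>lebesgue)
    \<le> m * (\<integral>\<^sup>+v. indicator (cbox 0 (\<chi> i. \<Delta> / w)) v * (\<integral>\<^sup>+x. D v x \<partial>lborel) \<partial>lborel)"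
proof -
  let ?Q = "cbox 0 (\<chi> i. \<Delta> / w) :: (real ^ 'n) set"
  define E where "E = (\<lambda>x. \<integral>\<^sup>+v. indicator ?Q v * D v x \<partial>lborel)"
  have E [measurable]: "E \<in> borel_measurable borel"
    unfolding E_def by measurable
  have le: "(\<integral>\<^sup>+u. indicator (cell t w k) u * D (u - node t k /\<^sub>R w) x \<partial>lborel) \<le> E x" for k x
  proof -
    have "(\<integral>\<^sup>+u. indicator (cell t w k) u * D (u - node t k /\<^sub>R w) x \<partial>lborel)
        \<le> (\<integral>\<^sup>+u. indicator ?Q (u - node t k /\<^sub>R w) * D (u - node t k /\<^sub>R w) x \<partial>lborel)"
      using cell_offset[OF w] by (intro nn_integral_mono mult_right_mono) (auto split: split_indicator)
    also have "\<dots> = E x"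
      unfolding E_def by (rule nn_integral_lborel_translate) measurable
    finally show ?thesis .
  qed
  have "(\<integral>\<^sup>+x. \<integral>\<^sup>+k. h (x - node t k /\<^sub>R w) *
        (\<integral>\<^sup>+u. indicator (cell t w k) u * D (u - node t k /\<^sub>R w) x \<partial>lborel) \<partial>count_space UNIV \<partial>lebesgue)
      \<le> (\<integral>\<^sup>+x. m * E x \<partial>lebesgue)"
  proof (rule nn_integral_mono)
    fix x
    have "(\<integral>\<^sup>+k. h (x - node t k /\<^sub>R w) *
        (\<integral>\<^sup>+u. indicator (cell t w k) u * D (u - node t k /\<^sub>R w) x \<partial>lborel) \<partial>count_space UNIV)
        \<le> (\<integral>\<^sup>+k. h (x - node t k /\<^sub>R w) * E x \<partial>count_space UNIV)"
      by (intro nn_integral_mono mult_left_mono le) auto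
    also have "\<dots> = (\<integral>\<^sup>+k. h (x - node t k /\<^sub>R w) \<partial>count_space UNIV) * E x"
      by (rule nn_integral_multc) auto
    also have "\<dots> \<le> m * E x" by (intro mult_right_mono m) auto
    finally show "(\<integral>\<^sup>+k. h (x - node t k /\<^sub>R w) *
        (\<integral>\<^sup>+u. indicator (cell t w k) u * D (u - node t k /\<^sub>R w) x \<partial>lborel) \<partial>count_space UNIV) \<le> m * E x" .
  qed
  also have "\<dots> = m * (\<integral>\<^sup>+x. E x \<partial>lborel)"
    by (simp add: nn_integral_completion nn_integral_cmult)
  also have "(\<integral>\<^sup>+x. E x \<partial>lborel) = (\<integral>\<^sup>+v. \<integral>\<^sup>+x. indicator ?Q v * D v x \<partial>lborel \<partial>lborel)"
    unfolding E_def by (rule lborel_pair.Fubini') measurable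
  also have "\<dots> = (\<integral>\<^sup>+v. indicator ?Q v * (\<integral>\<^sup>+x. D v x \<partial>lborel) \<partial>lborel)"
    by (intro nn_integral_cong nn_integral_cmult) measurable
  finally show ?thesis .
qed

end

subsection \<open>The modular of the approximation error\<close>

text \<open>Split at radius \<open>min \<gamma> r\<close>. Inside, the local power bound on
  \<open>L\<close> applies and the point lies in the ball of radius \<open>\<gamma>\<close>;
  outside, the global bound \<open>J\<close> leaves a tail integral as in (chi4).\<close>

lemma kernel_weighted_integral_le:
  fixes K :: "real ^ 'n::finite \<Rightarrow> real" and L :: "real ^ 'n \<Rightarrow> ennreal"
  assumes K: "integrable lebesgue K" and w: "w > 0" and \<nu>: "\<nu> > 0"
    and Lm [measurable]: "L \<in> borel_measurable borel" and C: "C \<ge> 0" "J \<ge> 0"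
    and L: "\<And>y. norm y \<le> r \<Longrightarrow> L y \<le> ennreal (C * norm y powr \<nu>)" "\<And>y. L y \<le> ennreal J"
  shows "ennreal (w ^ CARD('n)) * (\<integral>\<^sup>+y. ennreal \<bar>K (w *\<^sub>R y)\<bar> * L y \<partial>lebesgue)
    \<le> ennreal (C * (LINT s:{s. norm s \<le> \<gamma>}|lebesgue. w ^ CARD('n) * \<bar>K (w *\<^sub>R s)\<bar> * norm s powr \<nu>)
      + J * (LINT u:{u. norm u > min \<gamma> r}|lebesgue. w ^ CARD('n) * \<bar>K (w *\<^sub>R u)\<bar>))"
proof -
  let ?k = "\<lambda>y. w ^ CARD('n) * \<bar>K (w *\<^sub>R y)\<bar>"
  \<comment> \<open>The supports of \<open>p\<close> and \<open>q\<close> overlap if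
    \<open>r < \<gamma>\<close>. This is harmless because both functions are nonnegative and only an
    upper bound is sought.\<close>
  define p where "p = (\<lambda>y. indicator {s. norm s \<le> \<gamma>} y * (?k y * norm y powr \<nu>))"
  define q where "q = (\<lambda>y. indicator {u. norm u > min \<gamma> r} y * ?k y)"
  have Kw: "integrable lebesgue (\<lambda>y. K (w *\<^sub>R y))"
    using K w by (rule integrable_lebesgue_scaling)
  then have Kw_m [measurable]: "(\<lambda>y. K (w *\<^sub>R y)) \<in> borel_measurable lebesgue" by auto
  have [measurable]: "L \<in> borel_measurable lebesgue"
    using Lm by (auto intro: measurable_completion)
  have n_m [measurable]: "(\<lambda>y::real^'n. norm y) \<in> borel_measurable lebesgue"
    by (intro measurable_completion) auto
  have sets1 [measurable]: "{s::real^'n. norm s \<le> \<gamma>} \<in> sets lebesgue"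
    "{u::real^'n. norm u > min \<gamma> r} \<in> sets lebesgue"
    by (intro sets_completionI_sets; simp)+
  have k_int: "integrable lebesgue ?k"
    using Kw by simp
  have q_int: "integrable lebesgue q"
    unfolding q_def by (rule Bochner_Integration.integrable_bound[OF k_int]) (auto split: split_indicator)
  have p_int: "integrable lebesgue p"
  proof (rule Bochner_Integration.integrable_bound)
    show "integrable lebesgue (\<lambda>y. \<bar>\<gamma>\<bar> powr \<nu> * ?k y)" using k_int by simp
    show "AE y in lebesgue. norm (p y) \<le> norm (\<bar>\<gamma>\<bar> powr \<nu> * ?k y)"
    proof (intro AE_I2)
      fix y :: "real ^ 'n"
      have "?k y * norm y powr \<nu> \<le> ?k y * \<bar>\<gamma>\<bar> powr \<nu>" if "norm y \<le> \<gamma>"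
        using that w \<nu> by (intro mult_left_mono powr_mono2) auto
      then show "norm (p y) \<le> norm (\<bar>\<gamma>\<bar> powr \<nu> * ?k y)"
        using w by (auto simp: p_def abs_mult mult.commute split: split_indicator)
    qed
  qed (simp add: p_def)
  have p0: "p y \<ge> 0" and q0: "q y \<ge> 0" for y
    using w by (auto simp: p_def q_def)
  have le: "ennreal (w ^ CARD('n)) * (ennreal \<bar>K (w *\<^sub>R y)\<bar> * L y) \<le> ennreal (C * p y + J * q y)" for y
  proof -
    have eq: "ennreal (w ^ CARD('n)) * (ennreal \<bar>K (w *\<^sub>R y)\<bar> * L y) = ennreal (?k y) * L y"
      using w by (simp add: ennreal_mult mult.assoc)
    show ?thesis
    proof (cases "norm y \<le> min \<gamma> r")
      case True
      have "ennreal (?k y) * L y \<le> ennreal (?k y) * ennreal (C * norm y powr \<nu>)"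
        using True by (intro mult_left_mono L(1)) auto
      also have "\<dots> = ennreal (C * p y)"
        using True C w by (simp add: p_def ennreal_mult[symmetric] mult_ac)
      also have "\<dots> \<le> ennreal (C * p y + J * q y)"
        using C q0[of y] by (intro ennreal_leI) auto
      finally show ?thesis unfolding eq .
    next
      case False
      then have "y \<in> {u. norm u > min \<gamma> r}" by auto
      have "ennreal (?k y) * L y \<le> ennreal (?k y) * ennreal J"
        by (intro mult_left_mono L(2)) auto
      also have "\<dots> = ennreal (J * q y)"
        using \<open>y \<in> _\<close> C w by (simp add: q_def ennreal_mult[symmetric] mult_ac)
      also have "\<dots> \<le> ennreal (C * p y + J * q y)"
        using C p0[of y] by (intro ennreal_leI) auto
      finally show ?thesis unfolding eq .
    qed
  qed
  have "ennreal (w ^ CARD('n)) * (\<integral>\<^sup>+y. ennreal \<bar>K (w *\<^sub>R y)\<bar> * L y \<partial>lebesgue)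
      = (\<integral>\<^sup>+y. ennreal (w ^ CARD('n)) * (ennreal \<bar>K (w *\<^sub>R y)\<bar> * L y) \<partial>lebesgue)"
    by (rule nn_integral_cmult[symmetric]) measurable
  also have "\<dots> \<le> (\<integral>\<^sup>+y. ennreal (C * p y + J * q y) \<partial>lebesgue)"
    by (intro nn_integral_mono le)
  also have "\<dots> = ennreal (\<integral>y. C * p y + J * q y \<partial>lebesgue)"
    using p_int q_int p0 q0 C by (intro nn_integral_eq_integral) auto
  also have "(\<integral>y. C * p y + J * q y \<partial>lebesgue) = C * (\<integral>y. p y \<partial>lebesgue) + J * (\<integral>y. q y \<partial>lebesgue)"
    using p_int q_int by simp
  finally show ?thesis
    by (simp only: p_def q_def set_lebesgue_integral_def real_scaleR_def)
qed

text \<open>The operator sees its argument only through cell integrals, so equality almost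
  everywhere gives equality of the images at every point.\<close>

lemma kantorovich_cong_AE:
  assumes "f \<in> borel_measurable lebesgue" "g \<in> borel_measurable lebesgue"
    "AE x in lebesgue. f x = g x"
  shows "kantorovich t K w f = kantorovich t K w g"
proof -
  have "(LINT u:cell t w k|lebesgue. f u) = (LINT u:cell t w k|lebesgue. g u)" for k
    unfolding set_lebesgue_integral_def
  proof (rule integral_cong_AE)
    have [measurable]: "cell t w k \<in> sets lebesgue"
      unfolding cell_def by (rule lmeasurable_cbox[THEN fmeasurableD])
    note assms(1,2) [measurable]
    show "(\<lambda>x. indicator (cell t w k) x *\<^sub>R f x) \<in> borel_measurable lebesgue"
      "(\<lambda>x. indicator (cell t w k) x *\<^sub>R g x) \<in> borel_measurable lebesgue"
      by measurable
    show "AE x in lebesgue. indicator (cell t w k) x *\<^sub>R f x = indicator (cell t w k) x *\<^sub>R g x"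
      using assms(3) by (rule eventually_mono) simp
  qed
  then show ?thesis unfolding kantorovich_def by presburger
qed

section \<open>From the pointwise error to its modular\<close>

locale kantorovich_modular = even_convex \<Phi> + spaced_nodes t \<delta> \<Delta>
  for \<Phi> and t :: "'n::finite \<Rightarrow> int \<Rightarrow> real" and \<delta> \<Delta>
begin

abbreviation offset :: "real \<Rightarrow> int ^ 'n \<Rightarrow> real ^ 'n" where
  "offset w k \<equiv> node t k /\<^sub>R w"

text \<open>As the weight times the measure of the cell is 1, \<open>f x\<close> may be moved inside
  the mean. Jensen on the cell follows, then \<open>add_le\<close> at the intermediate point, which
  turns \<open>c\<close> into \<open>2 * c\<close>; finally the weight is replaced by its bound
  uniform in \<open>k\<close>.\<close>

lemma cell_jensen:
  assumes f [measurable]: "f \<in> borel_measurable borel"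
    and w: "w > 0" and c: "c \<ge> 0" and int: "set_integrable lborel (cell t w k) f"
  shows "ennreal (\<Phi> (c * (w ^ CARD('n) / cell_volume t k * (LINT u:cell t w k|lborel. f u) - f x)))
    \<le> ennreal ((w / \<delta>) ^ CARD('n)) *
      ((\<integral>\<^sup>+u. indicator (cell t w k) u * ennreal (\<Phi> (2 * c * (f u - f (u + (x - offset w k))))) \<partial>lborel)
     + (\<integral>\<^sup>+u. indicator (cell t w k) u * ennreal (\<Phi> (2 * c * (f x - f (x + (u - offset w k))))) \<partial>lborel))"
proof -
  let ?S = "cell t w k" and ?y = "\<lambda>u. x + (u - offset w k)"
  define W where "W = w ^ CARD('n) / cell_volume t k"
  have W: "W > 0" "emeasure lborel ?S * ennreal W = 1" "W \<le> (w / \<delta>) ^ CARD('n)"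
    using w cell_volume_pos[of k] emeasure_cell[OF w, of k] cell_weight_le[OF w, of k]
    by (auto simp: W_def)
  have S_fin: "emeasure lborel ?S < \<infinity>"
    unfolding cell_def by (rule emeasure_lborel_cbox_finite)
  have "measure lborel ?S * W = 1"
    using W(1,2) S_fin by (simp add: emeasure_eq_ennreal_measure ennreal_mult[symmetric] less_top[symmetric])
  moreover have const: "set_integrable lborel ?S (\<lambda>_. f x)"
    using S_fin by (simp add: set_integrable_def)
  moreover have "(LINT u:?S|lborel. f x) = measure lborel ?S * f x"
    using S_fin by (simp add: set_lebesgue_integral_def)
  moreover have "(LINT u:?S|lborel. c * (f u - f x)) = c * ((LINT u:?S|lborel. f u) - (LINT u:?S|lborel. f x))"
    using set_integral_diff(2)[OF int const] by (simp only: set_integral_mult_right)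
  ultimately have "W * (LINT u:?S|lborel. c * (f u - f x)) = c * (W * (LINT u:?S|lborel. f u) - (measure lborel ?S * W) * f x)"
    by (simp only:) (simp add: algebra_simps)
  then have "W * (LINT u:?S|lborel. c * (f u - f x)) = c * (W * (LINT u:?S|lborel. f u) - f x)"
    using \<open>measure lborel ?S * W = 1\<close> by simp
  then have "ennreal (\<Phi> (c * (W * (LINT u:?S|lborel. f u) - f x)))
      = ennreal (\<Phi> (W * (LINT u:?S|lborel. c * (f u - f x))))" by (simp only:)
  also have "\<dots> \<le> (\<integral>\<^sup>+u. ennreal W * indicator ?S u * ennreal (\<Phi> (c * (f u - f x))) \<partial>lborel)"
    using W by (intro jensen_average set_integrable_mult_right set_integral_diff(1) int const) auto
  also have "\<dots> \<le> (\<integral>\<^sup>+u. ennreal ((w / \<delta>) ^ CARD('n)) *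
      (indicator ?S u * ennreal (\<Phi> (2 * c * (f u - f (u + (x - offset w k)))))
     + indicator ?S u * ennreal (\<Phi> (2 * c * (f x - f (?y u))))) \<partial>lborel)"
  proof (rule nn_integral_mono)
    fix u
    have "\<Phi> (c * (f u - f x)) \<le> \<Phi> (2 * (c * (f u - f (?y u)))) + \<Phi> (2 * (c * (f (?y u) - f x)))"
      using add_le[of "c * (f u - f (?y u))" "c * (f (?y u) - f x)"] by (simp add: algebra_simps)
    also have "\<Phi> (2 * (c * (f (?y u) - f x))) = \<Phi> (2 * c * (f x - f (?y u)))"
      using even[of "2 * (c * (f (?y u) - f x))"] by (simp add: algebra_simps)
    \<comment> \<open>The intermediate point is a shift of \<open>u\<close> by a vector free of
      \<open>u\<close>, and also a shift of \<open>x\<close> by a vector free of \<open>x\<close>.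
      Each half of the estimate uses the form that suits it.\<close>
    also have "?y u = u + (x - offset w k)" by simp
    finally have "ennreal (\<Phi> (c * (f u - f x)))
        \<le> ennreal (\<Phi> (2 * c * (f u - f (u + (x - offset w k)))) + \<Phi> (2 * c * (f x - f (u + (x - offset w k)))))"
      by (intro ennreal_leI) (simp add: mult.assoc)
    also have "\<dots> = ennreal (\<Phi> (2 * c * (f u - f (u + (x - offset w k)))))
        + ennreal (\<Phi> (2 * c * (f x - f (?y u))))"
      by (simp add: algebra_simps)
    finally have le: "ennreal (\<Phi> (c * (f u - f x))) \<le> \<dots>" .
    show "ennreal W * indicator ?S u * ennreal (\<Phi> (c * (f u - f x)))
      \<le> ennreal ((w / \<delta>) ^ CARD('n)) *
      (indicator ?S u * ennreal (\<Phi> (2 * c * (f u - f (u + (x - offset w k)))))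
     + indicator ?S u * ennreal (\<Phi> (2 * c * (f x - f (?y u)))))"
    proof (cases "u \<in> ?S")
      case True
      have "ennreal W * ennreal (\<Phi> (c * (f u - f x))) \<le> ennreal ((w / \<delta>) ^ CARD('n)) *
          (ennreal (\<Phi> (2 * c * (f u - f (u + (x - offset w k))))) + ennreal (\<Phi> (2 * c * (f x - f (?y u)))))"
        using W(3) by (intro mult_mono ennreal_leI le) auto
      then show ?thesis using True by simp
    qed simp
  qed
  also have "\<dots> = ennreal ((w / \<delta>) ^ CARD('n)) *
      ((\<integral>\<^sup>+u. indicator ?S u * ennreal (\<Phi> (2 * c * (f u - f (u + (x - offset w k))))) \<partial>lborel)
     + (\<integral>\<^sup>+u. indicator ?S u * ennreal (\<Phi> (2 * c * (f x - f (?y u)))) \<partial>lborel))"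
    by (simp add: nn_integral_cmult nn_integral_add)
  finally show ?thesis unfolding W_def .
qed

text \<open>Of the factor \<open>4 * l * m\<close>, one 2 comes from separating the term with
  \<open>node_sum t K w x - 1\<close>, \<open>m\<close> from Jensen for the series, and the other 2
  from \<open>cell_jensen\<close>.\<close>

lemma kantorovich_pointwise:
  assumes f [measurable]: "f \<in> borel_measurable borel"
    and pos: "w > 0" "l > 0" "m > 0"
    and K: "(\<integral>\<^sup>+k. ennreal \<bar>K (w *\<^sub>R x - node t k)\<bar> \<partial>count_space UNIV) \<le> ennreal m"
    and int: "\<And>k. set_integrable lborel (cell t w k) f"
    and avg: "\<And>k. \<bar>w ^ CARD('n) / cell_volume t k * (LINT u:cell t w k|lborel. f u)\<bar> \<le> B"
  defines "h \<equiv> \<lambda>y. ennreal \<bar>K (w *\<^sub>R y)\<bar>"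
  shows "ennreal (\<Phi> (l * (kantorovich t K w f x - f x)))
    \<le> ennreal ((w / \<delta>) ^ CARD('n) / m) *
      ((\<integral>\<^sup>+k. h (x - offset w k) * (\<integral>\<^sup>+u. indicator (cell t w k) u *
          ennreal (\<Phi> (4 * l * m * (f u - f (u + (x - offset w k))))) \<partial>lborel) \<partial>count_space UNIV)
     + (\<integral>\<^sup>+k. h (x - offset w k) * (\<integral>\<^sup>+u. indicator (cell t w k) u *
          ennreal (\<Phi> (4 * l * m * (f x - f (x + (u - offset w k))))) \<partial>lborel) \<partial>count_space UNIV))
     + ennreal (\<Phi> ((node_sum t K w x - 1) * (2 * l * f x)))"
proof -
  define A where "A = (\<lambda>k. w ^ CARD('n) / cell_volume t k * (LINT u:cell t w k|lborel. f u))"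
  let ?a = "\<lambda>k. K (w *\<^sub>R x - node t k)"
  let ?X = "\<lambda>k. \<integral>\<^sup>+u. indicator (cell t w k) u *
          ennreal (\<Phi> (4 * l * m * (f u - f (u + (x - offset w k))))) \<partial>lborel"
  let ?Y = "\<lambda>k. \<integral>\<^sup>+u. indicator (cell t w k) u *
          ennreal (\<Phi> (4 * l * m * (f x - f (x + (u - offset w k))))) \<partial>lborel"
  let ?C = "(w / \<delta>) ^ CARD('n)"
  have K': "(\<integral>\<^sup>+k. ennreal \<bar>?a k\<bar> \<partial>count_space UNIV) < \<infinity>"
    using K by (simp add: le_less_trans)
  have A_bd: "\<bar>A k - f x\<bar> \<le> B + \<bar>f x\<bar>" for k
    using avg[of k] unfolding A_def by linarith
  have h: "h (x - offset w k) = ennreal \<bar>?a k\<bar>" for k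
    using pos(1) by (simp add: h_def scaleR_right_diff_distrib)
  \<comment> \<open>Absolute convergence of both series permits splitting the operator into the
    differences \<open>A k - f x\<close> and the node sum times \<open>f x\<close>.\<close>
  have s1: "(\<lambda>k. ?a k * (A k - f x)) summable_on UNIV"
    using A_bd by (intro mult_bounded_count_space(2)[OF K'])
  have s2: "(\<lambda>k. ?a k * f x) summable_on UNIV"
    by (intro mult_bounded_count_space(2)[OF K']) auto
  have "kantorovich t K w f x = (\<Sum>\<^sub>\<infinity>k\<in>UNIV. ?a k * A k)"
    unfolding kantorovich_def A_def set_lebesgue_integral_def
    by (subst integral_completion) auto
  also have "\<dots> = (\<Sum>\<^sub>\<infinity>k\<in>UNIV. ?a k * (A k - f x) + ?a k * f x)"
    by (simp add: algebra_simps)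
  also have "\<dots> = (\<Sum>\<^sub>\<infinity>k\<in>UNIV. ?a k * (A k - f x)) + (\<Sum>\<^sub>\<infinity>k\<in>UNIV. ?a k * f x)"
    by (rule infsum_add[OF s1 s2])
  also have "(\<Sum>\<^sub>\<infinity>k\<in>UNIV. ?a k * f x) = node_sum t K w x * f x"
    unfolding node_sum_def by (rule infsum_cmult_left')
  finally have split: "l * (kantorovich t K w f x - f x)
      = l * (\<Sum>\<^sub>\<infinity>k\<in>UNIV. ?a k * (A k - f x)) + l * ((node_sum t K w x - 1) * f x)"
    by (simp add: algebra_simps)
  have "\<Phi> (l * (kantorovich t K w f x - f x))
      \<le> \<Phi> (2 * (l * (\<Sum>\<^sub>\<infinity>k\<in>UNIV. ?a k * (A k - f x)))) + \<Phi> (2 * (l * ((node_sum t K w x - 1) * f x)))"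
    unfolding split by (rule add_le)
  also have "2 * (l * (\<Sum>\<^sub>\<infinity>k\<in>UNIV. ?a k * (A k - f x))) = (\<Sum>\<^sub>\<infinity>k\<in>UNIV. (2 * l) * (?a k * (A k - f x)))"
    by (simp only: infsum_cmult_right' mult.assoc)
  also have "(\<lambda>k. (2 * l) * (?a k * (A k - f x))) = (\<lambda>k. ?a k * (2 * l * (A k - f x)))"
    by (simp add: fun_eq_iff)
  also have "2 * (l * ((node_sum t K w x - 1) * f x)) = (node_sum t K w x - 1) * (2 * l * f x)"
    by simp
  finally have "ennreal (\<Phi> (l * (kantorovich t K w f x - f x)))
      \<le> ennreal (\<Phi> (\<Sum>\<^sub>\<infinity>k\<in>UNIV. ?a k * (2 * l * (A k - f x))))
        + ennreal (\<Phi> ((node_sum t K w x - 1) * (2 * l * f x)))"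
    by (simp add: ennreal_leI flip: ennreal_plus)
  also have "ennreal (\<Phi> (\<Sum>\<^sub>\<infinity>k\<in>UNIV. ?a k * (2 * l * (A k - f x))))
      \<le> (\<integral>\<^sup>+k. ennreal (\<bar>?a k\<bar> / m) * ennreal (\<Phi> (m * (2 * l * (A k - f x)))) \<partial>count_space UNIV)"
  proof (rule jensen_infsum[OF pos(3) K])
    fix k
    show "\<bar>2 * l * (A k - f x)\<bar> \<le> 2 * l * (B + \<bar>f x\<bar>)"
      using A_bd[of k] pos(2) by (simp add: abs_mult)
  qed
  also have "\<dots> \<le> (\<integral>\<^sup>+k. ennreal (?C / m) * (h (x - offset w k) * ?X k + h (x - offset w k) * ?Y k) \<partial>count_space UNIV)"
  proof (rule nn_integral_mono)
    fix k
    have "ennreal (\<Phi> (m * (2 * l * (A k - f x)))) \<le> ennreal ?C * (?X k + ?Y k)"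
      using cell_jensen[OF f pos(1), of "2 * l * m" k x] int[of k] pos
      unfolding A_def by (simp add: mult_ac)
    then have "ennreal (\<bar>?a k\<bar> / m) * ennreal (\<Phi> (m * (2 * l * (A k - f x))))
        \<le> ennreal (\<bar>?a k\<bar> / m) * (ennreal ?C * (?X k + ?Y k))"
      by (rule mult_left_mono) auto
    also have "\<dots> = ennreal (?C / m) * (h (x - offset w k) * (?X k + ?Y k))"
    proof -
      have "ennreal (\<bar>?a k\<bar> / m) * ennreal ?C = ennreal (?C / m) * ennreal \<bar>?a k\<bar>"
        using pos \<delta> by (simp add: ennreal_mult[symmetric])
      then show ?thesis unfolding h by (simp only: mult.assoc[symmetric])
    qed
    finally show "ennreal (\<bar>?a k\<bar> / m) * ennreal (\<Phi> (m * (2 * l * (A k - f x))))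
        \<le> ennreal (?C / m) * (h (x - offset w k) * ?X k + h (x - offset w k) * ?Y k)"
      by (simp only: distrib_left)
  qed
  also have "\<dots> = ennreal (?C / m) * ((\<integral>\<^sup>+k. h (x - offset w k) * ?X k \<partial>count_space UNIV)
      + (\<integral>\<^sup>+k. h (x - offset w k) * ?Y k \<partial>count_space UNIV))"
    by (simp add: nn_integral_cmult nn_integral_add)
  finally show ?thesis by (simp add: add_right_mono)
qed

text \<open>Integrates the pointwise bound. The same modulus \<open>L\<close> arises from both
  halves: in the first \<open>H u y\<close> is integrated over \<open>u\<close> at fixed shift
  \<open>y\<close>, in the second \<open>H x v\<close> over \<open>x\<close> at fixed shift
  \<open>v\<close>.\<close>

lemma modular_kantorovich_le:
  fixes K :: "real ^ 'n \<Rightarrow> real" and f :: "real ^ 'n \<Rightarrow> real"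
  assumes f [measurable]: "f \<in> borel_measurable borel"
    and pos: "w > 0" "l > 0" "m > 0"
    and K: "integrable lebesgue K"
    and m: "\<And>u. (\<integral>\<^sup>+k. ennreal \<bar>K (u - node t k)\<bar> \<partial>count_space UNIV) \<le> ennreal m"
    and b: "b > 0" "(\<integral>\<^sup>+x. ennreal (\<Phi> (b * f x)) \<partial>lborel) < \<infinity>"
    and D: "\<And>x. \<bar>node_sum t K w x - 1\<bar> \<le> D" "D \<le> 1"
    and N: "\<And>u. (\<integral>\<^sup>+k. indicator (cell t w k) u \<partial>count_space UNIV) \<le> of_nat N"
  defines "L \<equiv> \<lambda>s. \<integral>\<^sup>+x. ennreal (\<Phi> (4 * l * m * (f x - f (x + s)))) \<partial>lborel"
  shows "(\<integral>\<^sup>+x. ennreal (\<Phi> (l * (kantorovich t K w f x - f x))) \<partial>lebesgue)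
    \<le> ennreal ((w / \<delta>) ^ CARD('n) / m) *
        (of_nat N * (\<integral>\<^sup>+y. ennreal \<bar>K (w *\<^sub>R y)\<bar> * L y \<partial>lebesgue)
         + ennreal m * (\<integral>\<^sup>+v. indicator (cbox 0 (\<chi> i. \<Delta> / w)) v * L v \<partial>lborel))
      + ennreal D * (\<integral>\<^sup>+x. ennreal (\<Phi> (2 * l * f x)) \<partial>lborel)"
proof -
  obtain I where I: "I \<ge> 0" "(\<integral>\<^sup>+x. ennreal (\<Phi> (b * f x)) \<partial>lborel) = ennreal I"
    using b(2) by (cases "\<integral>\<^sup>+x. ennreal (\<Phi> (b * f x)) \<partial>lborel") auto
  define h where "h = (\<lambda>y. ennreal \<bar>K (w *\<^sub>R y)\<bar>)"
  have h [measurable]: "h \<in> borel_measurable lebesgue"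
    using integrable_lebesgue_scaling[OF K pos(1)] unfolding h_def by auto
  define H where "H = (\<lambda>u y. ennreal (\<Phi> (4 * l * m * (f u - f (u + y)))))"
  have H [measurable]: "(\<lambda>(u, y). H u y) \<in> borel_measurable (borel \<Otimes>\<^sub>M borel)"
    unfolding H_def by measurable
  have H' [measurable]: "(\<lambda>(v, x). H x v) \<in> borel_measurable (borel \<Otimes>\<^sub>M borel)"
    unfolding H_def by measurable
  define X where "X = (\<lambda>x. \<integral>\<^sup>+k. h (x - offset w k) *
      (\<integral>\<^sup>+u. indicator (cell t w k) u * H u (x - offset w k) \<partial>lborel) \<partial>count_space UNIV)"
  define Y where "Y = (\<lambda>x. \<integral>\<^sup>+k. h (x - offset w k) *
      (\<integral>\<^sup>+u. indicator (cell t w k) u * H x (u - offset w k) \<partial>lborel) \<partial>count_space UNIV)"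
  have hk: "(\<lambda>x. h (x - a)) \<in> borel_measurable lebesgue" for a
    by (rule nn_integral_lebesgue_translate(2)[OF h])
  have XY [measurable]: "X \<in> borel_measurable lebesgue" "Y \<in> borel_measurable lebesgue"
    unfolding X_def Y_def
    by (intro borel_measurable_nn_integral_count_space borel_measurable_times_ennreal hk
        measurable_completion; measurable)+
  have Z [measurable]: "(\<lambda>x. ennreal (\<Phi> (2 * l * f x))) \<in> borel_measurable lebesgue"
    by (intro measurable_completion) measurable
  \<comment> \<open>The finite modular of \<open>b * f\<close> bounds the cell averages uniformly in
    \<open>k\<close> for this \<open>w\<close>, which gives the convergence required
    pointwise.\<close>
  have avg: "set_integrable lborel (cell t w k) f"
    "\<bar>w ^ CARD('n) / cell_volume t k * (LINT u:cell t w k|lborel. f u)\<bar>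
      \<le> (1 + (w / \<delta>) ^ CARD('n) * (I / \<Phi> 1)) / b" for k
    using pos(1) I b(1) cell_volume_pos[of k]
    by (intro average_bound[OF f cell_borel b(1) _ I(1) emeasure_cell[OF pos(1)] _ cell_weight_le[OF pos(1)]]; simp)+
  have "(\<integral>\<^sup>+x. ennreal (\<Phi> (l * (kantorovich t K w f x - f x))) \<partial>lebesgue)
    \<le> (\<integral>\<^sup>+x. ennreal ((w / \<delta>) ^ CARD('n) / m) * (X x + Y x) + ennreal D * ennreal (\<Phi> (2 * l * f x)) \<partial>lebesgue)"
  proof (rule nn_integral_mono)
    fix x
    have "D \<ge> 0" using D(1)[of x] by linarith
    have "ennreal (\<Phi> (l * (kantorovich t K w f x - f x)))
      \<le> ennreal ((w / \<delta>) ^ CARD('n) / m) * (X x + Y x)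
        + ennreal (\<Phi> ((node_sum t K w x - 1) * (2 * l * f x)))"
      unfolding X_def Y_def h_def H_def
      by (rule kantorovich_pointwise[OF f pos m avg])
    also have "ennreal (\<Phi> ((node_sum t K w x - 1) * (2 * l * f x))) \<le> ennreal D * ennreal (\<Phi> (2 * l * f x))"
      using scale_le[OF D] \<open>D \<ge> 0\<close> by (subst ennreal_mult[symmetric]) (auto intro: ennreal_leI)
    finally show "ennreal (\<Phi> (l * (kantorovich t K w f x - f x)))
      \<le> ennreal ((w / \<delta>) ^ CARD('n) / m) * (X x + Y x) + ennreal D * ennreal (\<Phi> (2 * l * f x))"
      by (simp add: add_left_mono)
  qed
  also have "\<dots> = ennreal ((w / \<delta>) ^ CARD('n) / m) * ((\<integral>\<^sup>+x. X x \<partial>lebesgue) + (\<integral>\<^sup>+x. Y x \<partial>lebesgue))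
      + ennreal D * (\<integral>\<^sup>+x. ennreal (\<Phi> (2 * l * f x)) \<partial>lborel)"
    unfolding nn_integral_completion[of lborel "\<lambda>x. ennreal (\<Phi> (2 * l * f x))", symmetric]
    by (subst nn_integral_add, measurable, subst nn_integral_cmult, measurable,
        subst nn_integral_cmult, measurable, subst nn_integral_add, measurable)
  also have "\<dots> \<le> ennreal ((w / \<delta>) ^ CARD('n) / m) *
        (of_nat N * (\<integral>\<^sup>+y. h y * L y \<partial>lebesgue)
         + ennreal m * (\<integral>\<^sup>+v. indicator (cbox 0 (\<chi> i. \<Delta> / w)) v * L v \<partial>lborel))
      + ennreal D * (\<integral>\<^sup>+x. ennreal (\<Phi> (2 * l * f x)) \<partial>lborel)"
  proof (intro add_right_mono mult_left_mono add_mono)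
    show "(\<integral>\<^sup>+x. X x \<partial>lebesgue) \<le> of_nat N * (\<integral>\<^sup>+y. h y * L y \<partial>lebesgue)"
      using nn_integral_node_shift_le[where h = h and H = H, OF h H N]
      unfolding X_def L_def H_def .
    have hm: "(\<integral>\<^sup>+k. h (x - offset w k) \<partial>count_space UNIV) \<le> ennreal m" for x
      using m[of "w *\<^sub>R x"] pos(1) by (simp add: h_def scaleR_right_diff_distrib)
    show "(\<integral>\<^sup>+x. Y x \<partial>lebesgue)
        \<le> ennreal m * (\<integral>\<^sup>+v. indicator (cbox 0 (\<chi> i. \<Delta> / w)) v * L v \<partial>lborel)"
      using nn_integral_cell_shift_le[where h = h and D = "\<lambda>v x. H x v", OF pos(1) H' hm]
      unfolding Y_def L_def H_def .
  qed auto
  finally show ?thesis unfolding h_def .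
qed

section \<open>The modulus of continuity and the rate\<close>

lemma modulus_measurable:
  fixes f :: "real ^ 'n \<Rightarrow> real"
  assumes [measurable]: "f \<in> borel_measurable borel"
  shows "(\<lambda>s. \<integral>\<^sup>+x. ennreal (\<Phi> (c * (f x - f (x + s)))) \<partial>lborel) \<in> borel_measurable borel"
  by measurable

text \<open>Follows from \<open>add_le\<close>, evenness and translation invariance. Being uniform
  in \<open>s\<close>, it controls the modulus at shifts away from the origin, where the Lipschitz
  condition says nothing.\<close>

lemma modulus_le:
  fixes f :: "real ^ 'n \<Rightarrow> real"
  assumes [measurable]: "f \<in> borel_measurable borel"
  shows "(\<integral>\<^sup>+x. ennreal (\<Phi> (c * (f x - f (x + s)))) \<partial>lborel)
    \<le> 2 * (\<integral>\<^sup>+x. ennreal (\<Phi> (2 * c * f x)) \<partial>lborel)"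
proof -
  have "(\<integral>\<^sup>+x. ennreal (\<Phi> (c * (f x - f (x + s)))) \<partial>lborel)
      \<le> (\<integral>\<^sup>+x. ennreal (\<Phi> (2 * c * f x)) + ennreal (\<Phi> (2 * c * f (x - (- s)))) \<partial>lborel)"
  proof (rule nn_integral_mono)
    fix x
    have "\<Phi> (c * (f x - f (x + s))) \<le> \<Phi> (2 * (c * f x)) + \<Phi> (2 * (- (c * f (x + s))))"
      using add_le[of "c * f x" "- (c * f (x + s))"] by (simp add: algebra_simps)
    also have "\<Phi> (2 * (- (c * f (x + s)))) = \<Phi> (2 * c * f (x - (- s)))"
      using even[of "2 * c * f (x + s)"] by (simp add: mult.assoc)
    finally show "ennreal (\<Phi> (c * (f x - f (x + s))))
        \<le> ennreal (\<Phi> (2 * c * f x)) + ennreal (\<Phi> (2 * c * f (x - (- s))))"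
      by (simp add: ennreal_leI mult.assoc flip: ennreal_plus)
  qed
  also have "\<dots> = (\<integral>\<^sup>+x. ennreal (\<Phi> (2 * c * f x)) \<partial>lborel)
      + (\<integral>\<^sup>+x. ennreal (\<Phi> (2 * c * f (x - (- s)))) \<partial>lborel)"
    by (rule nn_integral_add) measurable
  also have "(\<integral>\<^sup>+x. ennreal (\<Phi> (2 * c * f (x - (- s)))) \<partial>lborel) = (\<integral>\<^sup>+x. ennreal (\<Phi> (2 * c * f x)) \<partial>lborel)"
    by (rule nn_integral_lborel_translate) measurable
  finally show ?thesis by (simp only: mult_2)
qed

text \<open>On the cube the Euclidean norm is at most the l1 norm, hence at most
  \<open>CARD('n) * \<Delta> / w\<close>, so the cube lies in the ball where the power bound holds.
  The volume factor will cancel the \<open>w ^ CARD('n)\<close> of the cell weights.\<close>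

lemma cube_integral_le:
  fixes L :: "real ^ 'n \<Rightarrow> ennreal"
  assumes w: "w > 0" and n: "CARD('n) * \<Delta> / w \<le> r" and \<nu>: "\<nu> > 0" and C: "C \<ge> 0"
    and L: "\<And>y. norm y \<le> r \<Longrightarrow> L y \<le> ennreal (C * norm y powr \<nu>)"
  shows "(\<integral>\<^sup>+v. indicator (cbox 0 (\<chi> i. \<Delta> / w)) v * L v \<partial>lborel)
    \<le> ennreal ((\<Delta> / w) ^ CARD('n) * (C * (CARD('n) * \<Delta> / w) powr \<nu>))"
proof -
  let ?Q = "cbox 0 (\<chi> i. \<Delta> / w) :: (real ^ 'n) set"
  let ?b = "C * (CARD('n) * \<Delta> / w) powr \<nu>"
  have nonneg: "0 \<le> \<Delta> / w" using w \<Delta> by simp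
  have "?Q \<noteq> {}" using nonneg by (auto simp: interval_ne_empty_cart)
  then have "measure lborel ?Q = (\<Delta> / w) ^ CARD('n)"
    by (simp add: content_cbox_cart)
  moreover have "emeasure lborel ?Q \<noteq> \<infinity>"
    using emeasure_lborel_cbox_finite[of 0 "\<chi> i. \<Delta> / w :: real ^ 'n"] by (simp add: less_top)
  ultimately have Q: "emeasure lborel ?Q = ennreal ((\<Delta> / w) ^ CARD('n))"
    by (simp add: emeasure_eq_ennreal_measure)
  have "(\<integral>\<^sup>+v. indicator ?Q v * L v \<partial>lborel) \<le> (\<integral>\<^sup>+v. ennreal ?b * indicator ?Q v \<partial>lborel)"
  proof (rule nn_integral_mono)
    fix v :: "real ^ 'n"
    have "L v \<le> ennreal ?b" if v: "v \<in> ?Q"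
    proof -
      have "norm v \<le> (\<Sum>i\<in>UNIV. \<bar>v $ i\<bar>)" by (rule norm_le_l1_cart)
      also have "\<dots> \<le> (\<Sum>i\<in>(UNIV::'n set). \<Delta> / w)"
        using v by (intro sum_mono) (auto simp: mem_box_cart)
      also have "\<dots> = CARD('n) * \<Delta> / w" by simp
      finally have nv: "norm v \<le> CARD('n) * \<Delta> / w" .
      then have "L v \<le> ennreal (C * norm v powr \<nu>)" using n by (intro L) linarith
      also have "\<dots> \<le> ennreal ?b"
        using nv \<nu> C by (intro ennreal_leI mult_left_mono powr_mono2) auto
      finally show ?thesis .
    qed
    then show "indicator ?Q v * L v \<le> ennreal ?b * indicator ?Q v"
      by (auto split: split_indicator)
  qed
  also have "\<dots> = ennreal ?b * emeasure lborel ?Q"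
    by (rule nn_integral_cmult_indicator) simp
  also have "\<dots> = ennreal ((\<Delta> / w) ^ CARD('n) * ?b)"
    unfolding Q using nonneg C by (simp add: ennreal_mult[symmetric] mult.commute)
  finally show ?thesis .
qed

lemma modular_kantorovich_rate:
  fixes K :: "real ^ 'n \<Rightarrow> real" and f :: "real ^ 'n \<Rightarrow> real"
  assumes f [measurable]: "f \<in> borel_measurable borel"
    and K: "integrable lebesgue K"
    and m: "m \<ge> 1" "\<And>u. (\<integral>\<^sup>+k. ennreal \<bar>K (u - node t k)\<bar> \<partial>count_space UNIV) \<le> ennreal m"
    and c2: "\<forall>\<^sub>F w in at_top. \<forall>x. \<bar>node_sum t K w x - 1\<bar> \<le> C2 * w powr (- \<mu>)" "C2 > 0" "\<mu> > 0"
    and c4: "(\<lambda>w. LINT u:{u. norm u > min \<gamma> r}|lebesgue. w ^ CARD('n) * \<bar>K (w *\<^sub>R u)\<bar>)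
      \<in> O[at_top](\<lambda>w. w powr (- \<alpha>))"
    and c5: "(\<lambda>w. LINT s:{s. norm s \<le> \<gamma>}|lebesgue. w ^ CARD('n) * \<bar>K (w *\<^sub>R s)\<bar> * norm s powr \<nu>)
      \<in> O[at_top](\<lambda>w. w powr (- \<theta>))"
    and \<nu>: "\<nu> > 0" and r: "r > 0"
    and lip: "a > 0" "C \<ge> 0"
      "\<And>s. norm s \<le> r \<Longrightarrow> (\<integral>\<^sup>+x. ennreal (\<Phi> (a * (f x - f (x + s)))) \<partial>lborel) \<le> ennreal (C * norm s powr \<nu>)"
    and b: "b > 0" "(\<integral>\<^sup>+x. ennreal (\<Phi> (b * f x)) \<partial>lborel) < \<infinity>"
  shows "\<exists>l>0. \<exists>C'>0. \<forall>\<^sub>F w in at_top.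
    (\<integral>\<^sup>+x. ennreal (\<Phi> (l * (kantorovich t K w f x - f x))) \<partial>lebesgue)
      \<le> ennreal (C' * w powr (- Min {\<theta>, \<nu>, \<mu>, \<alpha>}))"
proof -
  define \<epsilon> where "\<epsilon> = Min {\<theta>, \<nu>, \<mu>, \<alpha>}"
  have \<epsilon>: "\<epsilon> \<le> \<theta>" "\<epsilon> \<le> \<nu>" "\<epsilon> \<le> \<mu>" "\<epsilon> \<le> \<alpha>" by (auto simp: \<epsilon>_def)
  \<comment> \<open>\<open>c \<le> a\<close> makes the Lipschitz bound available for
    \<open>L\<close>, and \<open>2 * c \<le> b\<close> makes the bound of \<open>modulus_le\<close>
    finite.\<close>
  define c where "c = min a (b / 2)"
  have c: "c > 0" "c \<le> a" "2 * c \<le> b" using lip(1) b(1) by (auto simp: c_def)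
  \<comment> \<open>Chosen so that the factor \<open>4 * l * m\<close> of
    \<open>modular_kantorovich_le\<close> equals \<open>c\<close>; \<open>m \<ge> 1\<close> then
    ensures \<open>2 * l \<le> b\<close>.\<close>
  define l where "l = c / (4 * m)"
  have l: "l > 0" "4 * l * m = c" "2 * l \<le> b"
  proof -
    have "c / m \<le> c" using c m(1) by (simp add: field_simps)
    then show "2 * l \<le> b" using c by (simp add: l_def)
  qed (use c m(1) in \<open>auto simp: l_def\<close>)
  obtain I where I: "I \<ge> 0" "(\<integral>\<^sup>+x. ennreal (\<Phi> (b * f x)) \<partial>lborel) = ennreal I"
    using b(2) by (cases "\<integral>\<^sup>+x. ennreal (\<Phi> (b * f x)) \<partial>lborel") auto
  have I_le: "(\<integral>\<^sup>+x. ennreal (\<Phi> (e * f x)) \<partial>lborel) \<le> ennreal I" if "0 \<le> e" "e \<le> b" for e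
    unfolding I(2)[symmetric] using that
    by (intro nn_integral_mono ennreal_leI mono_abs) (auto simp: abs_mult intro!: mult_right_mono)
  define L where "L = (\<lambda>s. \<integral>\<^sup>+x. ennreal (\<Phi> (c * (f x - f (x + s)))) \<partial>lborel)"
  have Lm: "L \<in> borel_measurable borel"
    unfolding L_def by (rule modulus_measurable[OF f])
  have L1: "L s \<le> ennreal (C * norm s powr \<nu>)" if "norm s \<le> r" for s
  proof -
    have "L s \<le> (\<integral>\<^sup>+x. ennreal (\<Phi> (a * (f x - f (x + s)))) \<partial>lborel)"
      unfolding L_def using c
      by (intro nn_integral_mono ennreal_leI mono_abs) (auto simp: abs_mult intro!: mult_right_mono)
    also have "\<dots> \<le> ennreal (C * norm s powr \<nu>)" by (rule lip(3)[OF that])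
    finally show ?thesis .
  qed
  have L2: "L s \<le> ennreal (2 * I)" for s
  proof -
    have "L s \<le> 2 * (\<integral>\<^sup>+x. ennreal (\<Phi> (2 * c * f x)) \<partial>lborel)"
      unfolding L_def by (rule modulus_le[OF f])
    also have "\<dots> \<le> 2 * ennreal I"
      using c by (intro mult_left_mono I_le) auto
    also have "\<dots> = ennreal (2 * I)" using I(1) by (simp add: ennreal_mult)
    finally show ?thesis .
  qed
  obtain N :: nat where
    N: "\<And>w u. w > 0 \<Longrightarrow> (\<integral>\<^sup>+k. indicator (cell t w k) u \<partial>count_space UNIV) \<le> of_nat N"
    using cell_overlap by blast
  define P where "P = (\<lambda>w. LINT s:{s. norm s \<le> \<gamma>}|lebesgue. w ^ CARD('n) * \<bar>K (w *\<^sub>R s)\<bar> * norm s powr \<nu>)"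
  define R where "R = (\<lambda>w. LINT u:{u. norm u > min \<gamma> r}|lebesgue. w ^ CARD('n) * \<bar>K (w *\<^sub>R u)\<bar>)"
  obtain C5 where C5: "C5 > 0" "\<forall>\<^sub>F w in at_top. norm (P w) \<le> C5 * norm (w powr (- \<theta>))"
    using c5 unfolding P_def by (elim landau_o.bigE)
  obtain C4 where C4: "C4 > 0" "\<forall>\<^sub>F w in at_top. norm (R w) \<le> C4 * norm (w powr (- \<alpha>))"
    using c4 unfolding R_def by (elim landau_o.bigE)
  \<comment> \<open>\<open>B1\<close>, \<open>B2\<close> and \<open>B3\<close> are the constants of
    the three terms of \<open>modular_kantorovich_le\<close>: kernel-weighted modulus, modulus over
    the small cube, and deviation of the node sum from 1.\<close>
  define B1 where "B1 = N / (\<delta> ^ CARD('n) * m) * (C * C5 + 2 * I * C4)"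
  define B2 where "B2 = (\<Delta> / \<delta>) ^ CARD('n) * (C * (CARD('n) * \<Delta>) powr \<nu>)"
  define B3 where "B3 = C2 * I"
  have B: "B1 \<ge> 0" "B2 \<ge> 0" "B3 \<ge> 0"
    using \<delta> \<Delta> m(1) lip(2) C5(1) C4(1) c2(2) I(1) by (auto simp: B1_def B2_def B3_def)
  \<comment> \<open>The factor bounding the deviation of the node sum must be at most 1 for
    \<open>scale_le\<close> to apply.\<close>
  have small: "\<forall>\<^sub>F w in at_top. C2 * w powr (- \<mu>) \<le> 1"
  proof -
    have "((\<lambda>w. C2 * w powr (- \<mu>)) \<longlongrightarrow> C2 * 0) at_top"
      using c2(3) by (intro tendsto_intros tendsto_neg_powr filterlim_ident) auto
    then have "\<forall>\<^sub>F w in at_top. C2 * w powr (- \<mu>) < 1"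
      by (intro order_tendstoD(2)[where y = "C2 * 0"]) auto
    then show ?thesis by (rule eventually_mono) simp
  qed
  have "\<forall>\<^sub>F w in at_top.
    (\<integral>\<^sup>+x. ennreal (\<Phi> (l * (kantorovich t K w f x - f x))) \<partial>lebesgue)
      \<le> ennreal ((B1 + B2 + B3 + 1) * w powr (- \<epsilon>))"
    \<comment> \<open>\<open>w \<ge> 1\<close> allows every power to be compared with the slowest
      rate \<open>\<epsilon>\<close>; the last condition on \<open>w\<close> puts the cube of shifts
      inside the Lipschitz ball.\<close>
    using c2(1) small C5(2) C4(2) eventually_ge_at_top[of 1] eventually_ge_at_top[of "CARD('n) * \<Delta> / r"]
  proof eventually_elim
    case (elim w)
    then have w: "w > 0" "w \<ge> 1" by auto
    define E where "E = w powr (- \<epsilon>)"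
    have "E > 0" using w by (simp add: E_def)
    have mono: "w powr (- e) \<le> E" if "\<epsilon> \<le> e" for e
      unfolding E_def using that w by (intro powr_mono) auto
    let ?X = "\<integral>\<^sup>+y. ennreal \<bar>K (w *\<^sub>R y)\<bar> * L y \<partial>lebesgue"
    let ?Y = "\<integral>\<^sup>+v. indicator (cbox 0 (\<chi> i. \<Delta> / w)) v * L v \<partial>lborel"
    let ?Z = "\<integral>\<^sup>+x. ennreal (\<Phi> (2 * l * f x)) \<partial>lborel"
    have main: "(\<integral>\<^sup>+x. ennreal (\<Phi> (l * (kantorovich t K w f x - f x))) \<partial>lebesgue)
      \<le> ennreal ((w / \<delta>) ^ CARD('n) / m) * (of_nat N * ?X + ennreal m * ?Y)
        + ennreal (C2 * w powr (- \<mu>)) * ?Z"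
      using modular_kantorovich_le[OF f w(1) l(1) _ K m(2) b _ elim(2) N[OF w(1)]] elim(1) m(1)
      unfolding L_def l(2) by auto
    have X: "ennreal (w ^ CARD('n)) * ?X \<le> ennreal ((C * C5 + 2 * I * C4) * E)"
    proof -
      have "ennreal (w ^ CARD('n)) * ?X \<le> ennreal (C * P w + 2 * I * R w)"
        unfolding P_def R_def
        by (rule kernel_weighted_integral_le[OF K w(1) \<nu> Lm lip(2) _ L1 L2]) (use I(1) in simp_all)
      also have "\<dots> \<le> ennreal ((C * C5 + 2 * I * C4) * E)"
      proof (rule ennreal_leI)
        have "P w \<le> C5 * w powr (- \<theta>)" using elim(3) by simp
        also have "\<dots> \<le> C5 * E" using C5(1) \<epsilon>(1) by (intro mult_left_mono mono) auto
        finally have "C * P w \<le> C * (C5 * E)" using lip(2) by (rule mult_left_mono)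
        have "R w \<le> C4 * w powr (- \<alpha>)" using elim(4) by simp
        also have "\<dots> \<le> C4 * E" using C4(1) \<epsilon>(4) by (intro mult_left_mono mono) auto
        finally have "2 * I * R w \<le> 2 * I * (C4 * E)" using I(1) by (intro mult_left_mono) auto
        then show "C * P w + 2 * I * R w \<le> (C * C5 + 2 * I * C4) * E"
          using \<open>C * P w \<le> C * (C5 * E)\<close> by (simp add: algebra_simps)
      qed
      finally show ?thesis .
    qed
    have 1: "ennreal ((w / \<delta>) ^ CARD('n) / m) * (of_nat N * ?X) \<le> ennreal (B1 * E)"
    proof -
      have "ennreal ((w / \<delta>) ^ CARD('n) / m) * of_nat N
          = ennreal (N / (\<delta> ^ CARD('n) * m)) * ennreal (w ^ CARD('n))"
        using w \<delta> m(1)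
        by (simp add: ennreal_of_nat_eq_real_of_nat ennreal_mult[symmetric] power_divide mult_ac)
      then have "ennreal ((w / \<delta>) ^ CARD('n) / m) * (of_nat N * ?X)
          = ennreal (N / (\<delta> ^ CARD('n) * m)) * (ennreal (w ^ CARD('n)) * ?X)"
        by (simp only: mult.assoc[symmetric])
      also have "\<dots> \<le> ennreal (N / (\<delta> ^ CARD('n) * m)) * ennreal ((C * C5 + 2 * I * C4) * E)"
        by (rule mult_left_mono[OF X]) simp
      also have "\<dots> = ennreal (B1 * E)"
        using \<delta> m(1) by (subst ennreal_mult'[symmetric]) (auto simp: B1_def mult.assoc)
      finally show ?thesis .
    qed
    have 2: "ennreal ((w / \<delta>) ^ CARD('n) / m) * (ennreal m * ?Y) \<le> ennreal (B2 * E)"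
    proof -
      have "CARD('n) * \<Delta> / w \<le> r"
        using elim(6) w r by (simp add: field_simps)
      then have Y: "?Y \<le> ennreal ((\<Delta> / w) ^ CARD('n) * (C * (CARD('n) * \<Delta> / w) powr \<nu>))"
        by (rule cube_integral_le[OF w(1) _ \<nu> lip(2) L1])
      have "ennreal ((w / \<delta>) ^ CARD('n) / m) * (ennreal m * ?Y) = ennreal ((w / \<delta>) ^ CARD('n)) * ?Y"
        using w \<delta> m(1) by (simp add: mult.assoc[symmetric] ennreal_mult[symmetric])
      also have "\<dots> \<le> ennreal ((w / \<delta>) ^ CARD('n)) *
          ennreal ((\<Delta> / w) ^ CARD('n) * (C * (CARD('n) * \<Delta> / w) powr \<nu>))"
        by (rule mult_left_mono[OF Y]) simp
      \<comment> \<open>The powers \<open>w ^ CARD('n)\<close> cancel, and only the decay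
        \<open>w powr (- \<nu>)\<close> of the modulus survives.\<close>
      also have "\<dots> = ennreal (B2 * w powr (- \<nu>))"
        using w \<delta> \<Delta>
        by (subst ennreal_mult'[symmetric])
           (auto simp: B2_def power_divide powr_divide powr_minus field_simps)
      also have "\<dots> \<le> ennreal (B2 * E)"
        using B \<epsilon> by (intro ennreal_leI mult_left_mono mono) auto
      finally show ?thesis .
    qed
    have 3: "ennreal (C2 * w powr (- \<mu>)) * ?Z \<le> ennreal (B3 * E)"
    proof -
      have "ennreal (C2 * w powr (- \<mu>)) * ?Z \<le> ennreal (C2 * E) * ennreal I"
        using c2(2) \<epsilon> l by (intro mult_mono ennreal_leI mult_left_mono mono I_le) auto
      also have "\<dots> = ennreal (B3 * E)"
        using c2(2) \<open>E > 0\<close> I(1) by (simp add: B3_def ennreal_mult[symmetric] mult_ac)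
      finally show ?thesis .
    qed
    have "(\<integral>\<^sup>+x. ennreal (\<Phi> (l * (kantorovich t K w f x - f x))) \<partial>lebesgue)
        \<le> ennreal (B1 * E) + ennreal (B2 * E) + ennreal (B3 * E)"
      by (rule order_trans[OF main]) (simp only: distrib_left, intro add_mono 1 2 3)
    also have "\<dots> = ennreal (B1 * E + B2 * E + B3 * E)"
      using B \<open>E > 0\<close> by simp
    also have "\<dots> \<le> ennreal ((B1 + B2 + B3 + 1) * E)"
      using \<open>E > 0\<close> by (intro ennreal_leI) (simp add: algebra_simps)
    finally show ?case unfolding E_def .
  qed
  \<comment> \<open>The summand 1 keeps the constant positive even when all three contributions
    vanish.\<close>
  moreover have "B1 + B2 + B3 + 1 > 0" using B by linarith
  ultimately show ?thesis
    using l(1) unfolding \<epsilon>_def by blast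
qed

end

section \<open>Reduction to a Borel representative\<close>

theorem theorem5p2:
  fixes t :: "'n::finite \<Rightarrow> int \<Rightarrow> real"
    and K f :: "real ^ 'n \<Rightarrow> real"
    and \<phi> :: "real \<Rightarrow> real"
    and \<mu> \<alpha> \<nu> \<theta> \<gamma> :: real
  assumes "sampling_nodes t"
    and "phi_function \<phi>"
    and "convex_on {0..} \<phi>"
    and "sampling_kernel t \<mu> \<alpha> K"
    and "0 < \<nu>" and "\<nu> \<le> 1"
    and "f \<in> orlicz_space \<phi> \<inter> lip_class \<phi> \<nu>"
    and "\<theta> > 0" and "\<gamma> > 0"
    and "(\<lambda>w. LINT s:{s. norm s \<le> \<gamma>}|lebesgue. w ^ CARD('n) * \<bar>K (w *\<^sub>R s)\<bar> * norm s powr \<nu>)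
           \<in> O[at_top](\<lambda>w. w powr (- \<theta>))"
  shows "\<exists>l>0. \<exists>C>0. \<forall>\<^sub>F w in at_top.
           modular \<phi> (\<lambda>x. l * (kantorovich t K w f x - f x))
             \<le> ennreal (C * w powr (- Min {\<theta>, \<nu>, \<mu>, \<alpha>}))"
proof -
  obtain \<delta> \<Delta> where "\<delta> > 0" "\<Delta> > 0"
    and gap: "\<And>i k. \<delta> \<le> t i (k + 1) - t i k" "\<And>i k. t i (k + 1) - t i k \<le> \<Delta>"
    using assms(1) unfolding sampling_nodes_def by blast
  define \<Phi> where "\<Phi> = (\<lambda>u. \<phi> \<bar>u\<bar>)"
  interpret even_convex \<Phi>
    unfolding \<Phi>_def by (rule even_convex_abs[OF assms(2,3)])
  interpret spaced_nodes t \<delta> \<Delta>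
    by unfold_locales (use \<open>\<delta> > 0\<close> \<open>\<Delta> > 0\<close> gap in auto)
  interpret kantorovich_modular \<Phi> t \<delta> \<Delta> ..
  have modular_eq: "modular \<phi> g = (\<integral>\<^sup>+x. ennreal (\<Phi> (g x)) \<partial>lebesgue)" for g :: "real ^ 'n \<Rightarrow> real"
    by (simp add: modular_def \<Phi>_def)

  have K: "integrable lebesgue K" and "\<mu> > 0"
    and c4: "\<And>M. M > 0 \<Longrightarrow> (\<lambda>w. LINT u:{u. norm u > M}|lebesgue. w ^ CARD('n) * \<bar>K (w *\<^sub>R u)\<bar>)
      \<in> O[at_top](\<lambda>w. w powr (- \<alpha>))"
    using assms(4) unfolding sampling_kernel_def by blast+
  obtain \<rho> where "\<rho> > 0" "bounded (K ` ball 0 \<rho>)"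
    using assms(4) unfolding sampling_kernel_def by blast
  moreover obtain \<beta> where "\<beta> > 0" "abs_moment t K \<beta> < \<infinity>"
    using assms(4) unfolding sampling_kernel_def by blast
  ultimately obtain m0 where m0:
    "\<And>u. (\<integral>\<^sup>+k. ennreal \<bar>K (u - node t k)\<bar> \<partial>count_space UNIV) \<le> ennreal m0"
    using abs_node_sum_bounded by metis
  \<comment> \<open>Enlarging the bound to at least 1 meets the assumption \<open>m \<ge> 1\<close>
    of the rate lemma.\<close>
  have m: "(\<integral>\<^sup>+k. ennreal \<bar>K (u - node t k)\<bar> \<partial>count_space UNIV) \<le> ennreal (max 1 m0)" for u
    by (rule order_trans[OF m0]) (simp add: ennreal_leI)
  obtain C2 where C2: "C2 > 0"
    "\<forall>\<^sub>F w in at_top. \<forall>x. \<bar>node_sum t K w x - 1\<bar> \<le> C2 * w powr (- \<mu>)"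
    using assms(4) unfolding sampling_kernel_def by blast

  have f: "f \<in> borel_measurable lebesgue"
    using assms(7) by (simp add: orlicz_space_def)
  \<comment> \<open>\<open>f\<close> is only Lebesgue measurable, while joint measurability of
    \<open>f (x + s)\<close> in both variables, needed for Fubini, calls for a Borel
    function.\<close>
  obtain g where g [measurable]: "g \<in> borel_measurable borel" and fg: "AE x in lborel. f x = g x"
    using completion_ex_borel_measurable_real[OF f] by auto
  have fg': "AE x in lebesgue. f x = g x" using fg by (rule AE_completion)
  have g_leb: "g \<in> borel_measurable lebesgue"
    by (intro measurable_completion) simp
  \<comment> \<open>Translates of null sets are null; this is read off from translation invariance
    of the integral of \<open>\<bar>f x - g x\<bar>\<close>.\<close>
  have shift: "AE x in lebesgue. f (x + s) = g (x + s)" for s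
  proof -
    have "(\<integral>\<^sup>+x. ennreal \<bar>f x - g x\<bar> \<partial>lebesgue) = 0"
      using fg' f g_leb by (subst nn_integral_0_iff_AE) auto
    moreover have hm: "(\<lambda>x. ennreal \<bar>f x - g x\<bar>) \<in> borel_measurable lebesgue"
      using f g_leb by measurable
    ultimately have "(\<integral>\<^sup>+x. ennreal \<bar>f (x - (- s)) - g (x - (- s))\<bar> \<partial>lebesgue) = 0"
      using nn_integral_lebesgue_translate(1)[OF hm, of "- s"] by simp
    then show ?thesis
      using nn_integral_lebesgue_translate(2)[OF hm, of "- s"]
      by (subst (asm) nn_integral_0_iff_AE) auto
  qed

  obtain b where b: "b > 0" "modular \<phi> (\<lambda>x. b * f x) < \<infinity>"
    using assms(7) by (auto simp: orlicz_space_def)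
  have b': "(\<integral>\<^sup>+x. ennreal (\<Phi> (b * g x)) \<partial>lborel) < \<infinity>"
  proof -
    have "(\<integral>\<^sup>+x. ennreal (\<Phi> (b * g x)) \<partial>lborel) = (\<integral>\<^sup>+x. ennreal (\<Phi> (b * f x)) \<partial>lborel)"
      using fg by (intro nn_integral_cong_AE) auto
    then show ?thesis using b(2) by (simp only: modular_eq nn_integral_completion)
  qed
  obtain a C r where a: "a > 0" "C > 0" "r > 0"
    and lip: "\<And>s. norm s \<le> r \<Longrightarrow> modular \<phi> (\<lambda>x. a * (f x - f (x + s))) \<le> ennreal (C * norm s powr \<nu>)"
    using assms(7) unfolding lip_class_def by blast
  have lip': "(\<integral>\<^sup>+x. ennreal (\<Phi> (a * (g x - g (x + s)))) \<partial>lborel) \<le> ennreal (C * norm s powr \<nu>)"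
    if "norm s \<le> r" for s
  proof -
    have "(\<integral>\<^sup>+x. ennreal (\<Phi> (a * (g x - g (x + s)))) \<partial>lborel)
        = (\<integral>\<^sup>+x. ennreal (\<Phi> (a * (g x - g (x + s)))) \<partial>lebesgue)"
      by (rule nn_integral_completion[symmetric])
    also have "\<dots> = (\<integral>\<^sup>+x. ennreal (\<Phi> (a * (f x - f (x + s)))) \<partial>lebesgue)"
      using fg' shift[of s] by (intro nn_integral_cong_AE) auto
    finally show ?thesis using lip[OF that] by (simp only: modular_eq)
  qed

  have "\<exists>l>0. \<exists>C>0. \<forall>\<^sub>F w in at_top.
    (\<integral>\<^sup>+x. ennreal (\<Phi> (l * (kantorovich t K w g x - g x))) \<partial>lebesgue)
      \<le> ennreal (C * w powr (- Min {\<theta>, \<nu>, \<mu>, \<alpha>}))"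
    using a assms(5,9) \<open>\<mu> > 0\<close>
    by (intro modular_kantorovich_rate[OF g K _ m C2(2,1) _ c4 assms(10) _ _ _ _ lip' b(1) b']) auto
  \<comment> \<open>Passing from \<open>g\<close> back to \<open>f\<close> leaves the operator
    unchanged at every point and alters the subtracted function only on a null set.\<close>
  moreover have "modular \<phi> (\<lambda>x. l * (kantorovich t K w f x - f x))
      = (\<integral>\<^sup>+x. ennreal (\<Phi> (l * (kantorovich t K w g x - g x))) \<partial>lebesgue)" for l w
    unfolding modular_eq kantorovich_cong_AE[OF f g_leb fg']
    using fg' by (intro nn_integral_cong_AE) auto
  ultimately show ?thesis by simp
qed

end
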